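(* Let $G$ be a finitely generated acylindrically hyperbolic group. Then for every non-principal ultrafilter $\omega$ on $\mathbb{N}$ and every unbounded non-decreasing sequence $(d_n)$ of positive real numbers, $$\ker\left(G \curvearrowright \mathrm{Cone}_{\omega}(G,d_n)\right) = K(G).$$
   Context: Asymptotic cones. Let $G$ be a finitely generated group with finite generating set $S$ and word length $\|\cdot\|_S$, $\omega$ a non-principal ultrafilter on $\mathbb{N}$, and $(d_n)$ an unbounded non-decreasing sequence of positive reals. $\mathrm{Cone}_\omega(G,d_n)$ is the ultralimit of the rescaled Cayley graphs $(\Gamma(G,S), \frac{1}{d_n}d_S, e)$; its points are represented by sequences $\{x_n\}$ in $G$ with $\|x_n\|_S/d_n$ bounded (admissible sequences), where $\{x_n\}=\{y_n\}$ iff $\lim_\omega \|x_n^{-1}y_n\|_S/d_n=0$, with metric $d_\infty(\{x_n\},\{y_n\})=\lim_\omega \|x_n^{-1}y_n\|_S/d_n$. $G$ acts isometrically by $g\cdot\{x_n\}=\{gx_n\}$. The kernel of this action is the set of $g \in G$ with $\lim_\omega \|x_n^{-1}gx_n\|_S/d_n=0$ for all admissible $\{x_n\}$; it does not depend on $S$. Acylindrical hyperbolicity. A $\delta$-hyperbolic space is a geodesic metric space with uniformly thin geodesic triangles. An isometric action of $G$ on a metric space $X$ is acylindrical if for every $\epsilon>0$ there are $R,N>0$ such that $|\{g\in G: d(x,gx)\le\epsilon, d(y,gy)\le\epsilon\}|\le N$ whenever $d(x,y)\ge R$. An action on a $\delta$-hyperbolic space $X$ is non-elementary if the limit set of $G$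 in the Gromov boundary $\partial X$ has more than 2 points. $G$ is acylindrically hyperbolic if it admits a non-elementary acylindrical isometric action on some $\delta$-hyperbolic space. $K(G)$ denotes the unique maximal finite normal subgroup of $G$: the finite normal subgroup containing all finite normal subgroups (it is known to exist for acylindrically hyperbolic groups). *)

theory Defs
  imports "HOL-Algebra.Group_Action" "HOL-Algebra.Generated_Groups" "HOL-Analysis.Abstract_Metric_Spaces"
begin

section \<open>Asymptotic cones\<close>

definition word_length :: "('a, 'm) monoid_scheme \<Rightarrow> 'a set \<Rightarrow> 'a \<Rightarrow> nat" where
  "word_length G S g =
     (LEAST n. \<exists>ws. length ws = n \<and> set ws \<subseteq> S \<union> m_inv G ` S \<and> foldr (\<lambda>a b. a \<otimes>\<^bsub>G\<^esub> b) ws \<one>\<^bsub>G\<^esub> = g)"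

text \<open>Ultrafilters are taken as objects of the library type of filters; the members of the
  ultrafilter are the sets \<open>{n. P n}\<close> with \<open>eventually P \<omega>\<close>, and the limit along the ultrafilter
  is \<^term>\<open>(f \<longlongrightarrow> l) \<omega>\<close>.\<close>

definition nonprincipal_ultrafilter :: "'i filter \<Rightarrow> bool" where
  "nonprincipal_ultrafilter \<omega> \<longleftrightarrow>
     \<omega> \<noteq> bot \<and>
     (\<forall>P. eventually P \<omega> \<or> eventually (\<lambda>i. \<not> P i) \<omega>) \<and>
     (\<forall>i. \<not> eventually (\<lambda>j. j = i) \<omega>)"

definition admissible ::
    "('a, 'm) monoid_scheme \<Rightarrow> 'a set \<Rightarrow> (nat \<Rightarrow> real) \<Rightarrow> (nat \<Rightarrow> 'a) set" where
  "admissible G S d =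
     {x. (\<forall>n. x n \<in> carrier G) \<and> (\<exists>C. \<forall>n. real (word_length G S (x n)) / d n \<le> C)}"

definition cone_rel ::
    "('a, 'm) monoid_scheme \<Rightarrow> 'a set \<Rightarrow> nat filter \<Rightarrow> (nat \<Rightarrow> real) \<Rightarrow> ((nat \<Rightarrow> 'a) \<times> (nat \<Rightarrow> 'a)) set"
  where
  "cone_rel G S \<omega> d =
     {(x, y). x \<in> admissible G S d \<and> y \<in> admissible G S d \<and>
        ((\<lambda>n. real (word_length G S (inv\<^bsub>G\<^esub> (x n) \<otimes>\<^bsub>G\<^esub> y n)) / d n) \<longlongrightarrow> 0) \<omega>}"

text \<open>Points of the cone are classes of admissible sequences of group elements. Every point of a
  Cayley graph lies at distance at most \<open>1/2\<close> from a vertex and \<open>d\<close> tends to infinity, so sequences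
  of points in the interiors of edges give no further points in the ultralimit.\<close>

definition Cone ::
    "('a, 'm) monoid_scheme \<Rightarrow> 'a set \<Rightarrow> nat filter \<Rightarrow> (nat \<Rightarrow> real) \<Rightarrow> (nat \<Rightarrow> 'a) set set" where
  "Cone G S \<omega> d = admissible G S d // cone_rel G S \<omega> d"

text \<open>Elements of \<^term>\<open>BijGroup E\<close> are required to be undefined off \<open>E\<close>, hence the restricted
  abstraction.\<close>

definition cone_action ::
    "('a, 'm) monoid_scheme \<Rightarrow> 'a set \<Rightarrow> nat filter \<Rightarrow> (nat \<Rightarrow> real) \<Rightarrow>
     'a \<Rightarrow> (nat \<Rightarrow> 'a) set \<Rightarrow> (nat \<Rightarrow> 'a) set" where
  "cone_action G S \<omega> d g =
     (\<lambda>p\<in>Cone G S \<omega> d. cone_rel G S \<omega> d `` ((\<lambda>x n. g \<otimes>\<^bsub>G\<^esub> x n) ` p))"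


section \<open>Hyperbolic spaces and their boundary\<close>

definition geodesic_segment ::
    "'x set \<Rightarrow> ('x \<Rightarrow> 'x \<Rightarrow> real) \<Rightarrow> 'x \<Rightarrow> 'x \<Rightarrow> 'x set \<Rightarrow> bool" where
  "geodesic_segment X dX x y A \<longleftrightarrow>
     (\<exists>\<gamma>. \<gamma> ` {0..dX x y} = A \<and> A \<subseteq> X \<and> \<gamma> 0 = x \<and> \<gamma> (dX x y) = y \<and>
        (\<forall>s\<in>{0..dX x y}. \<forall>t\<in>{0..dX x y}. dX (\<gamma> s) (\<gamma> t) = \<bar>s - t\<bar>))"

text \<open>The thinness condition is stated for one side only; permuting the vertices cyclically
  gives the other two.\<close>

definition delta_hyperbolic :: "'x set \<Rightarrow> ('x \<Rightarrow> 'x \<Rightarrow> real) \<Rightarrow> real \<Rightarrow> bool" where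
  "delta_hyperbolic X dX \<delta> \<longleftrightarrow>
     Metric_space X dX \<and>
     (\<forall>x\<in>X. \<forall>y\<in>X. \<exists>A. geodesic_segment X dX x y A) \<and>
     (\<forall>x\<in>X. \<forall>y\<in>X. \<forall>z\<in>X. \<forall>A B C.
        geodesic_segment X dX x y A \<and> geodesic_segment X dX y z B \<and> geodesic_segment X dX z x C \<longrightarrow>
        (\<forall>a\<in>A. \<exists>b\<in>B \<union> C. dX a b \<le> \<delta>))"

definition gromov_product :: "('x \<Rightarrow> 'x \<Rightarrow> real) \<Rightarrow> 'x \<Rightarrow> 'x \<Rightarrow> 'x \<Rightarrow> real" where
  "gromov_product dX p x y = (dX p x + dX p y - dX x y) / 2"

text \<open>Sequential Gromov boundary, the usual one for spaces that need not be proper. Neither the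
  convergence condition nor the equivalence depends on the base point \<open>p\<close>.\<close>

definition gromov_sequences :: "'x set \<Rightarrow> ('x \<Rightarrow> 'x \<Rightarrow> real) \<Rightarrow> (nat \<Rightarrow> 'x) set" where
  "gromov_sequences X dX =
     {u. (\<forall>n. u n \<in> X) \<and>
        (\<forall>p\<in>X. LIM (i, j) sequentially \<times>\<^sub>F sequentially. gromov_product dX p (u i) (u j) :> at_top)}"

definition gromov_rel :: "'x set \<Rightarrow> ('x \<Rightarrow> 'x \<Rightarrow> real) \<Rightarrow> ((nat \<Rightarrow> 'x) \<times> (nat \<Rightarrow> 'x)) set" where
  "gromov_rel X dX =
     {(u, v). u \<in> gromov_sequences X dX \<and> v \<in> gromov_sequences X dX \<and>
        (\<forall>p\<in>X. LIM (i, j) sequentially \<times>\<^sub>F sequentially. gromov_product dX p (u i) (v j) :> at_top)}"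

definition gromov_boundary :: "'x set \<Rightarrow> ('x \<Rightarrow> 'x \<Rightarrow> real) \<Rightarrow> (nat \<Rightarrow> 'x) set set" where
  "gromov_boundary X dX = gromov_sequences X dX // gromov_rel X dX"

text \<open>A sequence in \<open>X\<close> converges to \<open>\<xi>\<close> in the boundary iff it belongs to the class \<open>\<xi>\<close>, so the
  limit set consists of the boundary points that are limits of sequences in an orbit.\<close>

definition limit_set ::
    "('a, 'm) monoid_scheme \<Rightarrow> 'x set \<Rightarrow> ('x \<Rightarrow> 'x \<Rightarrow> real) \<Rightarrow> ('a \<Rightarrow> 'x \<Rightarrow> 'x) \<Rightarrow> (nat \<Rightarrow> 'x) set set"
  where
  "limit_set G X dX \<phi> =
     {\<xi>\<in>gromov_boundary X dX.
        \<exists>x\<in>X. \<exists>g. (\<forall>n. g n \<in> carrier G) \<and> (\<lambda>n. \<phi> (g n) x) \<in> \<xi>}"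


section \<open>Acylindrically hyperbolic groups\<close>

definition isometric_action ::
    "('a, 'm) monoid_scheme \<Rightarrow> 'x set \<Rightarrow> ('x \<Rightarrow> 'x \<Rightarrow> real) \<Rightarrow> ('a \<Rightarrow> 'x \<Rightarrow> 'x) \<Rightarrow> bool" where
  "isometric_action G X dX \<phi> \<longleftrightarrow>
     group_action G X \<phi> \<and>
     (\<forall>g\<in>carrier G. \<forall>x\<in>X. \<forall>y\<in>X. dX (\<phi> g x) (\<phi> g y) = dX x y)"

definition acylindrical_action ::
    "('a, 'm) monoid_scheme \<Rightarrow> 'x set \<Rightarrow> ('x \<Rightarrow> 'x \<Rightarrow> real) \<Rightarrow> ('a \<Rightarrow> 'x \<Rightarrow> 'x) \<Rightarrow> bool" where
  "acylindrical_action G X dX \<phi> \<longleftrightarrow>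
     isometric_action G X dX \<phi> \<and>
     (\<forall>\<epsilon>>0. \<exists>R>0. \<exists>N::nat. N > 0 \<and>
        (\<forall>x\<in>X. \<forall>y\<in>X. dX x y \<ge> R \<longrightarrow>
           finite {g\<in>carrier G. dX x (\<phi> g x) \<le> \<epsilon> \<and> dX y (\<phi> g y) \<le> \<epsilon>} \<and>
           card {g\<in>carrier G. dX x (\<phi> g x) \<le> \<epsilon> \<and> dX y (\<phi> g y) \<le> \<epsilon>} \<le> N))"

definition non_elementary_action ::
    "('a, 'm) monoid_scheme \<Rightarrow> 'x set \<Rightarrow> ('x \<Rightarrow> 'x \<Rightarrow> real) \<Rightarrow> ('a \<Rightarrow> 'x \<Rightarrow> 'x) \<Rightarrow> bool" where
  "non_elementary_action G X dX \<phi> \<longleftrightarrow>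
     infinite (limit_set G X dX \<phi>) \<or> card (limit_set G X dX \<phi>) > 2"

text \<open>HOL cannot quantify over types inside a formula, so the type of points of the hyperbolic space
  is a parameter. As a hypothesis with a free type variable \<open>'x\<close> this covers spaces over
  every type.\<close>

definition acylindrically_hyperbolic :: "'x itself \<Rightarrow> ('a, 'm) monoid_scheme \<Rightarrow> bool" where
  "acylindrically_hyperbolic (_ :: 'x itself) G \<longleftrightarrow>
     group G \<and>
     (\<exists>(X :: 'x set) dX \<delta> \<phi>. delta_hyperbolic X dX \<delta> \<and>
        acylindrical_action G X dX \<phi> \<and> non_elementary_action G X dX \<phi>)"

definition is_max_finite_normal :: "('a, 'm) monoid_scheme \<Rightarrow> 'a set \<Rightarrow> bool" where
  "is_max_finite_normal G K \<longleftrightarrow>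
     K \<lhd> G \<and> finite K \<and> (\<forall>N. N \<lhd> G \<and> finite N \<longrightarrow> N \<subseteq> K)"

definition max_finite_normal :: "('a, 'm) monoid_scheme \<Rightarrow> 'a set" where
  "max_finite_normal G = (THE K. is_max_finite_normal G K)"

end

theory Submission
  imports Defs
begin

text \<open>Let \<open>k\<close> be in the kernel. If \<open>x\<^sub>n\<close> is an admissible sequence whose orbit \<open>x\<^sub>n e\<close> moves away from
  \<open>e\<close> in the hyperbolic space at linear speed in \<open>d\<^sub>n\<close>, then \<open>k\<close> displaces \<open>x\<^sub>n e\<close> only sublinearly, so
  the Gromov product of \<open>x\<^sub>n e\<close> and \<open>k x\<^sub>n e\<close> tends to infinity. Three limit points of the action yield
  a loxodromic element \<open>h\<close> and three such sequences \<open>s\<^sub>i h\<^sup>m e\<close>, with \<open>m\<close> of either sign, whose mutual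
  Gromov products are uniformly bounded; \<open>e\<close> and \<open>k e\<close> are then quasi-centres of nearly the same
  triangle, which bounds the displacement of \<open>e\<close> by a constant independent of \<open>k\<close>. The kernel is
  normal, so the same bound holds at every orbit point, and acylindricity at two distant orbit points
  makes it finite. Conversely finite normal subgroups act trivially because conjugates of their
  elements have bounded length. Hence the kernel is itself the maximal finite normal subgroup.\<close>

section \<open>Gromov products\<close>

text \<open>All estimates below use only the four-point inequality, at every base point; thin
  triangles serve once, to establish it.\<close>

locale gromov_hyperbolic = Metric_space X dX for X :: "'x set" and dX +
  fixes D :: real
  assumes D_nonneg: "0 \<le> D"
    and four_point: "\<lbrakk>p \<in> X; x \<in> X; y \<in> X; z \<in> X\<rbrakk> \<Longrightarrow>
      min (gromov_product dX p x y) (gromov_product dX p y z) - D \<le> gromov_product dX p x z"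
begin

abbreviation gp :: "'x \<Rightarrow> 'x \<Rightarrow> 'x \<Rightarrow> real" where "gp \<equiv> gromov_product dX"

lemma gp_commute: "gp p x y = gp p y x"
  by (simp add: gromov_product_def commute)

lemma gp_self_left: "p \<in> X \<Longrightarrow> gp p p x = 0"
  by (simp add: gromov_product_def)

lemma gp_nonneg: "\<lbrakk>p \<in> X; x \<in> X; y \<in> X\<rbrakk> \<Longrightarrow> 0 \<le> gp p x y"
  using triangle[of x p y] by (simp add: gromov_product_def commute)

lemma gp_le_dist: "\<lbrakk>p \<in> X; x \<in> X; y \<in> X\<rbrakk> \<Longrightarrow> gp p x y \<le> dX p x"
  using triangle[of p x y] by (simp add: gromov_product_def commute)

lemma gp_add: "gp p q x + gp q p x = dX p q"
  by (simp add: gromov_product_def commute field_simps)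

lemma gp_base_change:
  "\<lbrakk>p \<in> X; q \<in> X; x \<in> X; y \<in> X\<rbrakk> \<Longrightarrow> gp p x y \<le> gp q x y + dX p q"
  using triangle[of p q x] triangle[of p q y] by (simp add: gromov_product_def field_simps)

lemma gp_point_change:
  "\<lbrakk>p \<in> X; x \<in> X; x' \<in> X; y \<in> X\<rbrakk> \<Longrightarrow> gp p x y \<le> gp p x' y + dX x x'"
  using triangle[of p x' x] triangle[of x' x y] by (simp add: gromov_product_def commute field_simps)

section \<open>Local-to-global principle for chains with long steps and small turns\<close>

text \<open>Backtracking does not accumulate. By induction the product at \<open>x n\<close> is at
  most \<open>b + D\<close>, so a step of length \<open>a\<close> makes \<open>x 0\<close> and
  \<open>x n\<close> share more than \<open>b + D\<close> as seen from \<open>x (n + 1)\<close>. As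
  \<open>x n\<close> and \<open>x (n + 2)\<close> share at most \<open>b\<close> there, the
  four-point inequality leaves at most \<open>b + D\<close> for \<open>x 0\<close> and
  \<open>x (n + 2)\<close>.\<close>

lemma chain_product_last:
  fixes x :: "nat \<Rightarrow> 'x"
  assumes x: "\<And>i. x i \<in> X" and "0 \<le> b" and ab: "2 * b + 2 * D < a"
    and b: "\<And>i. i + 2 \<le> N \<Longrightarrow> gp (x (i + 1)) (x i) (x (i + 2)) \<le> b"
    and a: "\<And>i. i < N \<Longrightarrow> a \<le> dX (x i) (x (i + 1))"
    and "n < N"
  shows "gp (x n) (x 0) (x (n + 1)) \<le> b + D"
  using \<open>n < N\<close>
proof (induction n)
  case 0
  then show ?case using gp_self_left[OF x] \<open>0 \<le> b\<close> D_nonneg by simp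
next
  case (Suc n)
  then have IH: "gp (x n) (x 0) (x (n + 1)) \<le> b + D" by simp
  have "a \<le> gp (x n) (x 0) (x (n + 1)) + gp (x (n + 1)) (x 0) (x n)"
    using a[of n] Suc.prems gp_add[of "x n" "x (n + 1)" "x 0"] by (simp add: gp_commute)
  moreover have "min (gp (x (n + 1)) (x n) (x 0)) (gp (x (n + 1)) (x 0) (x (n + 2))) - D \<le> b"
    using four_point[OF x x x x, of "n + 1" n 0 "n + 2"] b[of n] Suc.prems by simp
  ultimately show ?case using IH ab by (simp add: gp_commute min_def split: if_splits)
qed

text \<open>Each step gains its length \<open>a\<close> minus twice the overlap \<open>b + D\<close>
  with the way back to \<open>x 0\<close>.\<close>

lemma chain_dist:
  fixes x :: "nat \<Rightarrow> 'x"
  assumes x: "\<And>i. x i \<in> X" and "0 \<le> b" and ab: "2 * b + 2 * D < a"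
    and b: "\<And>i. i + 2 \<le> N \<Longrightarrow> gp (x (i + 1)) (x i) (x (i + 2)) \<le> b"
    and a: "\<And>i. i < N \<Longrightarrow> a \<le> dX (x i) (x (i + 1))"
    and "n \<le> N"
  shows "real n * (a - 2 * b - 2 * D) \<le> dX (x 0) (x n)"
  using \<open>n \<le> N\<close>
proof (induction n)
  case 0
  then show ?case by simp
next
  case (Suc n)
  have "gp (x n) (x 0) (x (n + 1)) \<le> b + D"
    using chain_product_last[OF x \<open>0 \<le> b\<close> ab b a] Suc.prems by simp
  moreover have "a \<le> dX (x n) (x (n + 1))" using a[of n] Suc.prems by simp
  ultimately have "dX (x 0) (x n) + (a - 2 * b - 2 * D) \<le> dX (x 0) (x (n + 1))"
    by (simp add: gromov_product_def commute[of "x n" "x 0"] field_simps)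
  then show ?case using Suc by (simp add: algebra_simps)
qed

text \<open>Both halves of the chain, seen from \<open>x n\<close>, are compared with the single
  step to \<open>x (n + 1)\<close>. The past shares at most \<open>b + D\<close> with it, the future
  at least \<open>a - b - D\<close>, which exceeds \<open>b + 2 * D\<close>; this is where the third
  \<open>D\<close> in the hypothesis goes.\<close>

lemma chain_product:
  fixes x :: "nat \<Rightarrow> 'x"
  assumes x: "\<And>i. x i \<in> X" and "0 \<le> b" and ab: "2 * b + 3 * D < a"
    and b: "\<And>i. i + 2 \<le> N \<Longrightarrow> gp (x (i + 1)) (x i) (x (i + 2)) \<le> b"
    and a: "\<And>i. i < N \<Longrightarrow> a \<le> dX (x i) (x (i + 1))"
    and "n + k \<le> N"
  shows "gp (x n) (x 0) (x (n + k)) \<le> b + 2 * D"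
proof (cases k)
  case 0
  then show ?thesis
    using gp_self_left[OF x] \<open>0 \<le> b\<close> D_nonneg by (simp add: gp_commute)
next
  case (Suc l)
  have ab': "2 * b + 2 * D < a" using ab D_nonneg by simp
  \<comment> \<open>The chain is read backwards from \<open>x (n + k)\<close>, so that the one-step
    bound applies to the turn at \<open>x (n + 1)\<close>. Truncated subtraction keeps
    \<open>y\<close> total.\<close>
  define y where "y i = x (n + k - i)" for i
  have "gp (y l) (y 0) (y (l + 1)) \<le> b + D"
  proof (rule chain_product_last[where N = k and a = a])
    show "gp (y (i + 1)) (y i) (y (i + 2)) \<le> b" if "i + 2 \<le> k" for i
    proof -
      have "n + k - i = n + k - (i + 2) + 2" "n + k - (i + 1) = n + k - (i + 2) + 1"
        using that by auto
      then show ?thesis using b[of "n + k - (i + 2)"] that \<open>n + k \<le> N\<close>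
        unfolding y_def by (simp add: gp_commute)
    qed
    show "a \<le> dX (y i) (y (i + 1))" if "i < k" for i
    proof -
      have "n + k - i = n + k - (i + 1) + 1" using that by auto
      then show ?thesis using a[of "n + k - (i + 1)"] that \<open>n + k \<le> N\<close>
        unfolding y_def by (simp add: commute)
    qed
  qed (use Suc x ab' \<open>0 \<le> b\<close> in \<open>auto simp: y_def\<close>)
  then have "gp (x (n + 1)) (x n) (x (n + k)) \<le> b + D"
    using Suc by (simp add: y_def gp_commute)
  moreover have "a \<le> dX (x n) (x (n + 1))" using a[of n] Suc \<open>n + k \<le> N\<close> by simp
  ultimately have "a - b - D \<le> gp (x n) (x (n + 1)) (x (n + k))"
    using gp_add[of "x n" "x (n + 1)" "x (n + k)"] by linarith
  moreover have "gp (x n) (x 0) (x (n + 1)) \<le> b + D"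
    using chain_product_last[OF x \<open>0 \<le> b\<close> ab' b a] Suc \<open>n + k \<le> N\<close> by simp
  moreover have "min (gp (x n) (x 0) (x (n + k))) (gp (x n) (x (n + k)) (x (n + 1))) - D
      \<le> gp (x n) (x 0) (x (n + 1))"
    by (rule four_point[OF x x x x])
  ultimately show ?thesis using ab by (simp add: gp_commute min_def split: if_splits)
qed

section \<open>Quasi-centres of triangles\<close>

text \<open>Pigeonhole: seen from \<open>o1\<close>, at most one of the three vertices has product
  above \<open>K + D\<close> with \<open>o2\<close>, and likewise with the roles exchanged. Hence
  one vertex has small product on both sides, and its two products add up to
  \<open>dX o1 o2\<close>.\<close>

lemma dist_quasi_centres:
  assumes "o1 \<in> X" "o2 \<in> X" "A \<in> X" "B \<in> X" "C \<in> X"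
    and 1: "gp o1 A B \<le> K" "gp o1 B C \<le> K" "gp o1 A C \<le> K"
    and 2: "gp o2 A B \<le> K" "gp o2 B C \<le> K" "gp o2 A C \<le> K"
  shows "dX o1 o2 \<le> 2 * K + 2 * D"
proof -
  have f: "gp p Y q \<le> K + D \<or> gp p q Z \<le> K + D"
    if "p \<in> X" "q \<in> X" "Y \<in> X" "Z \<in> X" "gp p Y Z \<le> K" for p q Y Z
    using four_point[of p Y q Z] that by linarith
  note f1 = f[OF assms(1,2)] and f2 = f[OF assms(2,1)]
  have "gp o1 A o2 \<le> K + D \<and> gp o2 A o1 \<le> K + D \<or>
        gp o1 B o2 \<le> K + D \<and> gp o2 B o1 \<le> K + D \<or>
        gp o1 C o2 \<le> K + D \<and> gp o2 C o1 \<le> K + D"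
    using f1[of A B] f1[of B C] f1[of A C] f2[of A B] f2[of B C] f2[of A C] assms
    by (auto simp: gp_commute)
  then show ?thesis
    using gp_add[of o1 o2 A] gp_add[of o1 o2 B] gp_add[of o1 o2 C]
    by (auto simp: gp_commute)
qed

text \<open>Replacing each endpoint by one in nearly the same direction costs one application of the
  four-point inequality, hence one \<open>D\<close> each.\<close>

lemma gp_transfer:
  assumes "p \<in> X" "y \<in> X" "z \<in> X" "y' \<in> X" "z' \<in> X"
    and "gp p y z \<le> K" "K + 2 * D < gp p y y'" "K + 2 * D < gp p z z'"
  shows "gp p y' z' \<le> K + 2 * D"
  using four_point[of p y y' z] four_point[of p y' z' z] assms D_nonneg gp_commute[of p z z']
  by linarith

text \<open>The point \<open>o1\<close> is also a quasi-centre of the primed triangle, with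
  \<open>K + 2 * D\<close> for \<open>K\<close>. In the application \<open>o2\<close> and the primed
  vertices are the images of \<open>o1\<close> and the vertices under a kernel element.\<close>

lemma dist_moved_centre:
  assumes o: "o1 \<in> X" "o2 \<in> X"
    and pts: "A \<in> X" "B \<in> X" "C \<in> X" "A' \<in> X" "B' \<in> X" "C' \<in> X"
    and 1: "gp o1 A B \<le> K" "gp o1 B C \<le> K" "gp o1 A C \<le> K"
    and 2: "gp o2 A' B' \<le> K" "gp o2 B' C' \<le> K" "gp o2 A' C' \<le> K"
    and near: "K + 2 * D < gp o1 A A'" "K + 2 * D < gp o1 B B'" "K + 2 * D < gp o1 C C'"
  shows "dX o1 o2 \<le> 2 * K + 6 * D"
proof -
  note f = gp_transfer[OF o(1)]
  have "dX o1 o2 \<le> 2 * (K + 2 * D) + 2 * D"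
    by (rule dist_quasi_centres[OF o pts(4-6)])
      (use f[of A B A' B'] f[of B C B' C'] f[of A C A' C'] assms D_nonneg in auto)
  then show ?thesis by simp
qed

section \<open>Equivalence of Gromov sequences\<close>

lemma gromov_sequencesD:
  assumes "u \<in> gromov_sequences X dX" "p \<in> X"
  shows "\<exists>N. \<forall>i\<ge>N. \<forall>j\<ge>N. T \<le> gp p (u i) (u j)"
proof -
  have "eventually (\<lambda>(i, j). T \<le> gp p (u i) (u j)) (sequentially \<times>\<^sub>F sequentially)"
    using assms by (auto simp: gromov_sequences_def filterlim_at_top split_def)
  then show ?thesis by (auto simp: eventually_prod_sequentially)
qed

lemma gromov_rel_iff:
  "(u, v) \<in> gromov_rel X dX \<longleftrightarrow> u \<in> gromov_sequences X dX \<and> v \<in> gromov_sequences X dX \<and>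
     (\<forall>p\<in>X. \<forall>T. \<exists>N. \<forall>i\<ge>N. \<forall>j\<ge>N. T \<le> gp p (u i) (v j))"
proof -
  have *: "(LIM (i, j) sequentially \<times>\<^sub>F sequentially. gp p (u i) (v j) :> at_top) \<longleftrightarrow>
      (\<forall>T. \<exists>N. \<forall>i\<ge>N. \<forall>j\<ge>N. T \<le> gp p (u i) (v j))" for p
    unfolding filterlim_at_top split_def eventually_prod_sequentially by fastforce
  show ?thesis by (simp add: gromov_rel_def *)
qed

lemma gromov_relD:
  assumes "(u, v) \<in> gromov_rel X dX" "p \<in> X"
  shows "\<exists>N. \<forall>i\<ge>N. \<forall>j\<ge>N. T \<le> gp p (u i) (v j)"
  using assms by (simp add: gromov_rel_iff)

lemma equiv_gromov_rel: "equiv (gromov_sequences X dX) (gromov_rel X dX)"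
proof (rule equivI)
  show "gromov_rel X dX \<subseteq> gromov_sequences X dX \<times> gromov_sequences X dX"
    by (auto simp: gromov_rel_def)
  show "refl_on (gromov_sequences X dX) (gromov_rel X dX)"
    using gromov_sequencesD by (auto simp: refl_on_def gromov_rel_iff)
  show "sym (gromov_rel X dX)"
    unfolding sym_def gromov_rel_iff by (metis gp_commute)
  show "trans (gromov_rel X dX)"
  proof (rule transI)
    fix u v w assume uv: "(u, v) \<in> gromov_rel X dX" and vw: "(v, w) \<in> gromov_rel X dX"
    have mem: "u i \<in> X" "v i \<in> X" "w i \<in> X" for i
      using uv vw by (auto simp: gromov_rel_def gromov_sequences_def)
    have "\<exists>N. \<forall>i\<ge>N. \<forall>j\<ge>N. T \<le> gp p (u i) (w j)" if "p \<in> X" for p T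
    proof -
      obtain N1 where N1: "\<And>i j. \<lbrakk>N1 \<le> i; N1 \<le> j\<rbrakk> \<Longrightarrow> T + D \<le> gp p (u i) (v j)"
        using gromov_relD[OF uv \<open>p \<in> X\<close>] by meson
      obtain N2 where N2: "\<And>i j. \<lbrakk>N2 \<le> i; N2 \<le> j\<rbrakk> \<Longrightarrow> T + D \<le> gp p (v i) (w j)"
        using gromov_relD[OF vw \<open>p \<in> X\<close>] by meson
      have "T \<le> gp p (u i) (w j)" if "max N1 N2 \<le> i" "max N1 N2 \<le> j" for i j
        using four_point[OF \<open>p \<in> X\<close> mem(1)[of i] mem(2)[of "max N1 N2"] mem(3)[of j]]
          N1[of i "max N1 N2"] N2[of "max N1 N2" j] that by simp
      then show ?thesis by blast
    qed
    then show "(u, w) \<in> gromov_rel X dX"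
      using uv vw unfolding gromov_rel_iff by blast
  qed
qed

text \<open>Inequivalence only says that the product stays below some \<open>T\<close> at
  arbitrarily late pairs. One such pair suffices: the tail of each sequence is concentrated in one
  direction, so the bound spreads to all late pairs at the cost of \<open>2 * D\<close>, and to the
  base point \<open>e\<close> at the cost of \<open>dX e p\<close>.\<close>

lemma gromov_product_bounded_if_not_rel:
  assumes u: "u \<in> gromov_sequences X dX" and v: "v \<in> gromov_sequences X dX"
    and uv: "(u, v) \<notin> gromov_rel X dX" and e: "e \<in> X"
  shows "\<exists>K N. \<forall>i\<ge>N. \<forall>j\<ge>N. gp e (u i) (v j) \<le> K"
proof -
  have mem: "u i \<in> X" "v i \<in> X" for i
    using u v by (auto simp: gromov_sequences_def)
  obtain p T where p: "p \<in> X" and T: "\<And>N. \<exists>i\<ge>N. \<exists>j\<ge>N. gp p (u i) (v j) < T"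
    using uv u v unfolding gromov_rel_iff by (meson not_le)
  obtain N1 where N1: "\<And>i j. \<lbrakk>N1 \<le> i; N1 \<le> j\<rbrakk> \<Longrightarrow> T + 2 * D \<le> gp p (u i) (u j)"
    using gromov_sequencesD[OF u p] by meson
  obtain N2 where N2: "\<And>i j. \<lbrakk>N2 \<le> i; N2 \<le> j\<rbrakk> \<Longrightarrow> T + 2 * D \<le> gp p (v i) (v j)"
    using gromov_sequencesD[OF v p] by meson
  obtain i j where ij: "i \<ge> max N1 N2" "j \<ge> max N1 N2" "gp p (u i) (v j) < T"
    using T by blast
  have "gp e (u k) (v l) \<le> T + 2 * D + dX e p" if "max N1 N2 \<le> k" "max N1 N2 \<le> l" for k l
    using four_point[OF p mem(1)[of i] mem(1)[of k] mem(2)[of j]]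
      four_point[OF p mem(1)[of k] mem(2)[of l] mem(2)[of j]]
      gp_base_change[OF e p mem(1)[of k] mem(2)[of l]] N1[of i k] N2[of l j] ij that D_nonneg
    by (simp add: min_def split: if_splits)
  then show ?thesis by blast
qed

end

section \<open>From thin triangles to the four-point inequality\<close>

lemma geodesic_segment_dist:
  assumes "geodesic_segment X dX x y A" "q \<in> A" "0 \<le> dX x y"
  shows "q \<in> X" "dX x y = dX x q + dX q y"
proof -
  obtain \<gamma> where \<gamma>: "\<gamma> ` {0..dX x y} = A" "A \<subseteq> X" "\<gamma> 0 = x" "\<gamma> (dX x y) = y"
    and iso: "\<And>s t. \<lbrakk>s \<in> {0..dX x y}; t \<in> {0..dX x y}\<rbrakk> \<Longrightarrow> dX (\<gamma> s) (\<gamma> t) = \<bar>s - t\<bar>"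
    using assms(1) unfolding geodesic_segment_def by metis
  obtain t where t: "t \<in> {0..dX x y}" "q = \<gamma> t" using \<gamma> assms(2) by auto
  show "q \<in> X" using assms(2) \<gamma> by auto
  show "dX x y = dX x q + dX q y"
    using iso[of 0 t] iso[of t "dX x y"] t \<gamma> assms(3) by auto
qed

lemma geodesic_segment_ends:
  assumes "geodesic_segment X dX x y A" "0 \<le> dX x y"
  shows "x \<in> A" "y \<in> A"
proof -
  obtain \<gamma> where \<gamma>: "\<gamma> ` {0..dX x y} = A" "\<gamma> 0 = x" "\<gamma> (dX x y) = y"
    using assms(1) unfolding geodesic_segment_def by metis
  show "x \<in> A" using \<gamma> assms(2) by force
  show "y \<in> A" using \<gamma> assms(2) by force
qed

text \<open>On a side of a thin triangle the points near the second side and those near the third side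
  cover everything, so a point near both exists up to an arbitrary error (here 2); no continuity
  is needed.\<close>

lemma interval_cover_close:
  fixes l :: real
  assumes "0 \<le> l" and cover: "\<And>t. t \<in> {0..l} \<Longrightarrow> P t \<or> Q t" and "P 0" "Q l"
  obtains s t where "s \<in> {0..l}" "t \<in> {0..l}" "P s" "Q t" "\<bar>s - t\<bar> \<le> 2"
proof -
  define E where "E = {t \<in> {0..l}. P t}"
  have "0 \<in> E" using assms by (simp add: E_def)
  have bdd: "bdd_above E" by (rule bdd_aboveI[of _ l]) (simp add: E_def)
  have "Sup E - 1 < Sup E" by simp
  then obtain s where s: "s \<in> E" "Sup E - 1 < s"
    using less_cSup_iff[of E] \<open>0 \<in> E\<close> bdd by blast
  have "s \<le> Sup E" using cSup_upper[OF s(1) bdd] .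
  show ?thesis
  proof (cases "l \<le> Sup E + 1")
    case True
    then show ?thesis using that[of s l] s \<open>Q l\<close> \<open>0 \<le> l\<close> unfolding E_def by auto
  next
    case False
    have "Sup E + 1 \<notin> E" using cSup_upper[OF _ bdd, of "Sup E + 1"] by auto
    moreover have "0 \<le> Sup E" using cSup_upper[OF \<open>0 \<in> E\<close> bdd] .
    ultimately have "Q (Sup E + 1)" using cover[of "Sup E + 1"] False unfolding E_def by auto
    then show ?thesis
      using that[of s "Sup E + 1"] s False \<open>s \<le> Sup E\<close> \<open>0 \<le> Sup E\<close> unfolding E_def by auto
  qed
qed

text \<open>The Gromov product agrees up to \<open>2 * \<delta> + 2\<close> with the distance from
  \<open>p\<close> to a geodesic (\<open>near\<close> and \<open>far\<close>). Thinness moves a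
  point of one side to another side, which adds the last \<delta>.\<close>

lemma delta_hyperbolic_imp_gromov_hyperbolic:
  assumes hyp: "delta_hyperbolic X dX \<delta>" and "X \<noteq> {}"
  shows "gromov_hyperbolic X dX (3 * \<delta> + 2)"
proof -
  interpret Metric_space X dX using hyp by (simp add: delta_hyperbolic_def)
  have geo: "\<exists>A. geodesic_segment X dX x y A" if "x \<in> X" "y \<in> X" for x y
    using hyp that by (simp add: delta_hyperbolic_def)
  have thin: "\<exists>b\<in>B \<union> C. dX a b \<le> \<delta>"
    if "x \<in> X" "y \<in> X" "z \<in> X" "geodesic_segment X dX x y A" "geodesic_segment X dX y z B"
      "geodesic_segment X dX z x C" "a \<in> A" for x y z A B C a
    using hyp that unfolding delta_hyperbolic_def by blast
  \<comment> \<open>The sign of \<delta> is not part of \<open>delta_hyperbolic\<close>; a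
    degenerate triangle at one point forces it.\<close>
  have \<delta>: "0 \<le> \<delta>"
  proof -
    obtain x where x: "x \<in> X" using \<open>X \<noteq> {}\<close> by auto
    obtain A where A: "geodesic_segment X dX x x A" using geo x by blast
    then have "x \<in> A" using x by (auto simp: geodesic_segment_def)
    then obtain b where "dX x b \<le> \<delta>" using thin[OF x x x A A A] by blast
    then show ?thesis using nonneg order_trans by blast
  qed
  have near: "gromov_product dX p x y \<le> dX p q"
    if "geodesic_segment X dX x y A" "q \<in> A" "p \<in> X" "x \<in> X" "y \<in> X" for p x y q A
    using geodesic_segment_dist[OF that(1,2) nonneg] triangle[of p q x] triangle[of p q y] that
    by (simp add: gromov_product_def commute)
  have far: "\<exists>q\<in>A. dX p q \<le> gromov_product dX p x z + 2 * \<delta> + 2"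
    if A: "geodesic_segment X dX x z A" and p: "p \<in> X" and x: "x \<in> X" and z: "z \<in> X" for p x z A
  proof -
    obtain \<gamma> where \<gamma>: "\<gamma> ` {0..dX x z} = A" "A \<subseteq> X" "\<gamma> 0 = x" "\<gamma> (dX x z) = z"
      and iso: "\<And>s t. \<lbrakk>s \<in> {0..dX x z}; t \<in> {0..dX x z}\<rbrakk> \<Longrightarrow> dX (\<gamma> s) (\<gamma> t) = \<bar>s - t\<bar>"
      using A unfolding geodesic_segment_def by metis
    obtain B where B: "geodesic_segment X dX z p B" using geo p z by blast
    obtain C where C: "geodesic_segment X dX p x C" using geo p x by blast
    have BC: "z \<in> B" "x \<in> C"
      using geodesic_segment_ends[OF B nonneg] geodesic_segment_ends[OF C nonneg] by auto
    define P where "P t = (\<exists>c\<in>C. dX (\<gamma> t) c \<le> \<delta>)" for t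
    define Q where "Q t = (\<exists>b\<in>B. dX (\<gamma> t) b \<le> \<delta>)" for t
    obtain s t where st: "s \<in> {0..dX x z}" "t \<in> {0..dX x z}" "P s" "Q t" "\<bar>s - t\<bar> \<le> 2"
    proof (rule interval_cover_close[of "dX x z" P Q])
      show "P t \<or> Q t" if "t \<in> {0..dX x z}" for t
        using thin[OF x z p A B C, of "\<gamma> t"] that \<gamma> by (auto simp: P_def Q_def)
      show "P 0" using BC(2) \<gamma>(3) x \<delta> unfolding P_def by (intro bexI[of _ x]) auto
      show "Q (dX x z)" using BC(1) \<gamma>(4) z \<delta> unfolding Q_def by (intro bexI[of _ z]) auto
    qed auto
    obtain c where c: "c \<in> C" "dX (\<gamma> s) c \<le> \<delta>" using st by (auto simp: P_def)
    obtain b where b: "b \<in> B" "dX (\<gamma> t) b \<le> \<delta>" using st by (auto simp: Q_def)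
    have mem: "\<gamma> s \<in> A" "\<gamma> t \<in> A" "\<gamma> s \<in> X" "\<gamma> t \<in> X" using st \<gamma> by auto
    note c' = geodesic_segment_dist[OF C c(1) nonneg]
    note b' = geodesic_segment_dist[OF B b(1) nonneg]
    \<comment> \<open>Passing through \<open>c\<close> gives \<open>dX p (\<gamma> s) \<le> dX p x -
      dX x (\<gamma> s) + 2 * \<delta>\<close>; passing through \<open>b\<close> and
      \<open>\<gamma> t\<close> gives the same with \<open>z\<close> for \<open>x\<close> and an
      extra 4. The claim is the average of the two.\<close>
    have "dX (\<gamma> s) (\<gamma> t) \<le> 2" using iso st by simp
    then have "dX p (\<gamma> s) \<le> gromov_product dX p x z + 2 * \<delta> + 2"
      using c' b' geodesic_segment_dist(2)[OF A mem(1) nonneg]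
        triangle[of p c "\<gamma> s"] triangle[of x c "\<gamma> s"]
        triangle[of p b "\<gamma> t"] triangle[of z b "\<gamma> t"]
        triangle[of p "\<gamma> t" "\<gamma> s"] triangle[of z "\<gamma> t" "\<gamma> s"] mem p x z c(2) b(2)
      by (simp add: gromov_product_def commute field_simps)
    then show ?thesis using mem by blast
  qed
  show ?thesis
  proof
    show "0 \<le> 3 * \<delta> + 2" using \<delta> by simp
    fix p x y z assume mem: "p \<in> X" "x \<in> X" "y \<in> X" "z \<in> X"
    obtain A where A: "geodesic_segment X dX x z A" using geo mem by blast
    obtain B where B: "geodesic_segment X dX z y B" using geo mem by blast
    obtain C where C: "geodesic_segment X dX y x C" using geo mem by blast
    obtain q where q: "q \<in> A" "dX p q \<le> gromov_product dX p x z + 2 * \<delta> + 2"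
      using far[OF A] mem by blast
    obtain r where r: "r \<in> B \<union> C" "dX q r \<le> \<delta>" using thin[OF _ _ _ A B C q(1)] mem by blast
    have "min (gromov_product dX p x y) (gromov_product dX p y z) \<le> dX p r"
      using r(1) near[OF B, of r p] near[OF C, of r p] mem
      by (auto simp: gromov_product_def commute min_le_iff_disj)
    moreover have "dX p r \<le> dX p q + dX q r"
      using triangle[of p q r] mem geodesic_segment_dist(1)[OF A q(1) nonneg] r
        geodesic_segment_dist(1)[OF B _ nonneg] geodesic_segment_dist(1)[OF C _ nonneg] by blast
    ultimately show "min (gromov_product dX p x y) (gromov_product dX p y z) - (3 * \<delta> + 2)
        \<le> gromov_product dX p x z"
      using q(2) r(2) by simp
  qed
qed

section \<open>Loxodromic elements and limit directions\<close>

locale hyperbolic_action = gromov_hyperbolic X dX D + group G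
  for X :: "'x set" and dX D and G :: "('a, 'm) monoid_scheme" (structure) +
  fixes \<phi> :: "'a \<Rightarrow> 'x \<Rightarrow> 'x"
  assumes isometric: "isometric_action G X dX \<phi>"
begin

sublocale group_action G X \<phi>
  using isometric by (simp add: isometric_action_def)

lemma act_dist: "\<lbrakk>g \<in> carrier G; x \<in> X; y \<in> X\<rbrakk> \<Longrightarrow> dX (\<phi> g x) (\<phi> g y) = dX x y"
  using isometric by (simp add: isometric_action_def)

lemma act_gp:
  "\<lbrakk>g \<in> carrier G; p \<in> X; x \<in> X; y \<in> X\<rbrakk> \<Longrightarrow> gp (\<phi> g p) (\<phi> g x) (\<phi> g y) = gp p x y"
  by (simp add: gromov_product_def act_dist)

lemma act_closed: "\<lbrakk>g \<in> carrier G; x \<in> X\<rbrakk> \<Longrightarrow> \<phi> g x \<in> X"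
  using element_image by blast

lemma act_one: "x \<in> X \<Longrightarrow> \<phi> \<one> x = x"
  by (metis id_eq_one restrict_apply')

lemma act_inv_cancel: "\<lbrakk>g \<in> carrier G; x \<in> X\<rbrakk> \<Longrightarrow> \<phi> g (\<phi> (inv g) x) = x"
  using composition_rule[of x g "inv g"] act_one by simp

lemma act_dist_inv:
  "\<lbrakk>g \<in> carrier G; x \<in> X; y \<in> X\<rbrakk> \<Longrightarrow> dX x (\<phi> g y) = dX (\<phi> (inv g) x) y"
  using act_dist[of g "\<phi> (inv g) x" y] by (simp add: act_closed act_inv_cancel)

text \<open>Partial products \<open>w i\<close> of the letters \<open>u i\<close> trace a chain in
  the orbit of \<open>e\<close>. Translating by the inverse of \<open>w (i + 1)\<close> moves each
  turn to \<open>e\<close>, where only two consecutive letters are seen.\<close>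

lemma orbit_chain:
  fixes u w :: "nat \<Rightarrow> 'a"
  assumes e: "e \<in> X" and u: "\<And>i. u i \<in> carrier G" and w0: "w 0 = \<one>"
    and wS: "\<And>i. w (Suc i) = w i \<otimes> u i"
  shows "w i \<in> carrier G" "dX (\<phi> (w i) e) (\<phi> (w (i + 1)) e) = dX e (\<phi> (u i) e)"
    "gp (\<phi> (w (i + 1)) e) (\<phi> (w i) e) (\<phi> (w (i + 2)) e)
      = gp e (\<phi> (inv (u i)) e) (\<phi> (u (i + 1)) e)"
proof -
  have w: "w i \<in> carrier G" for i by (induction i) (auto simp: w0 wS u)
  then show "w i \<in> carrier G" .
  show "dX (\<phi> (w i) e) (\<phi> (w (i + 1)) e) = dX e (\<phi> (u i) e)"
    using act_dist[OF w e act_closed[OF u e]] by (simp add: wS composition_rule e u w)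
  have "\<phi> (w i) e = \<phi> (w (i + 1)) (\<phi> (inv (u i)) e)"
    by (simp add: wS composition_rule e u w act_inv_cancel act_closed)
  moreover have "\<phi> (w (i + 2)) e = \<phi> (w (i + 1)) (\<phi> (u (i + 1)) e)"
    using composition_rule[OF e w[of "i + 1"] u[of "i + 1"]] by (simp add: wS)
  ultimately show "gp (\<phi> (w (i + 1)) e) (\<phi> (w i) e) (\<phi> (w (i + 2)) e)
      = gp e (\<phi> (inv (u i)) e) (\<phi> (u (i + 1)) e)"
    by (simp add: act_gp act_closed e u w)
qed

section \<open>Construction of a loxodromic element\<close>

text \<open>The alternating word in \<open>s\<close> and \<open>t\<close> traces a chain whose turns
  are exactly the two bounded products, so the local-to-global estimates apply to the powers of
  \<open>s \<otimes> t\<close>.\<close>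

lemma loxodromic_product:
  assumes e: "e \<in> X" and s: "s \<in> carrier G" and t: "t \<in> carrier G"
    and "0 \<le> b" and ab: "2 * b + 3 * D < a"
    and as: "a \<le> dX e (\<phi> s e)" and at: "a \<le> dX e (\<phi> t e)"
    and st: "gp e (\<phi> (inv s) e) (\<phi> t e) \<le> b" and ts: "gp e (\<phi> (inv t) e) (\<phi> s e) \<le> b"
  shows "real m * (a - 2 * b - 2 * D) \<le> dX e (\<phi> ((s \<otimes> t) [^] m) e)"
    and "gp e (\<phi> ((s \<otimes> t) [^] m) e) (\<phi> (inv ((s \<otimes> t) [^] m)) e) \<le> b + 2 * D"
proof -
  define u where "u i = (if even i then s else t)" for i :: nat
  define w where "w = rec_nat \<one> (\<lambda>i y. y \<otimes> u i)"
  define x where "x i = \<phi> (w i) e" for i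
  let ?h = "s \<otimes> t"
  have u: "u i \<in> carrier G" for i using s t by (simp add: u_def)
  have w0: "w 0 = \<one>" and wS: "w (Suc i) = w i \<otimes> u i" for i by (simp_all add: w_def)
  note chain = orbit_chain[where u = u and w = w, OF e u w0 wS]
  have w: "w i \<in> carrier G" for i by (rule chain(1))
  have w2: "w (2 * m) = ?h [^] m" for m
  proof (induction m)
    case (Suc m)
    have "w (2 * Suc m) = w (2 * m) \<otimes> s \<otimes> t" by (simp add: w_def u_def)
    then show ?case using Suc s t by (simp add: m_assoc)
  qed (simp add: w_def)
  have xX: "x i \<in> X" for i by (simp add: x_def act_closed w e)
  have a': "a \<le> dX (x i) (x (i + 1))" for i
    using chain(2)[of i] as at by (simp add: x_def u_def)
  have b': "gp (x (i + 1)) (x i) (x (i + 2)) \<le> b" for i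
    using chain(3)[of i] st ts by (simp add: x_def u_def)
  have ab': "2 * b + 2 * D < a" using ab D_nonneg by simp
  have x0: "x 0 = e" by (simp add: x_def w_def act_one e)
  have h: "?h [^] m \<in> carrier G" using s t by simp
  \<comment> \<open>The \<open>m\<close>-th power of \<open>s \<otimes> t\<close> is the vertex with
    index \<open>2 * m\<close>; half of the progress is given away.\<close>
  have "real m * (a - 2 * b - 2 * D) \<le> real (2 * m) * (a - 2 * b - 2 * D)"
    using ab' by (intro mult_right_mono) auto
  also have "\<dots> \<le> dX (x 0) (x (2 * m))"
    by (rule chain_dist[OF xX \<open>0 \<le> b\<close> ab', of "2 * m"]) (use a' b' in auto)
  finally show "real m * (a - 2 * b - 2 * D) \<le> dX e (\<phi> (?h [^] m) e)"
    by (simp only: x0) (simp add: x_def w2)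
  \<comment> \<open>The vertex \<open>x (2 * m)\<close> is the midpoint of a chain of
    \<open>4 * m\<close> steps. Translated to \<open>e\<close>, the two ends become the images of
    \<open>e\<close> under the inverse \<open>m\<close>-th power and the \<open>m\<close>-th
    power.\<close>
  have "gp (x (2 * m)) (x 0) (x (2 * m + 2 * m)) \<le> b + 2 * D"
    by (rule chain_product[OF xX \<open>0 \<le> b\<close> ab, of "4 * m"]) (use a' b' in auto)
  moreover have "x (2 * m + 2 * m) = \<phi> (?h [^] m) (\<phi> (?h [^] m) e)"
    using w2[of "2 * m"] s t nat_pow_mult[of ?h m m] composition_rule[OF e h h]
    by (simp add: x_def mult_2)
  moreover have "x (2 * m) = \<phi> (?h [^] m) e" by (simp add: x_def w2)
  moreover have "e = \<phi> (?h [^] m) (\<phi> (inv (?h [^] m)) e)"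
    by (simp add: act_inv_cancel h e)
  ultimately have "gp (\<phi> (?h [^] m) e) (\<phi> (?h [^] m) (\<phi> (inv (?h [^] m)) e))
      (\<phi> (?h [^] m) (\<phi> (?h [^] m) e)) \<le> b + 2 * D"
    using x0 by simp
  then show "gp e (\<phi> (?h [^] m) e) (\<phi> (inv (?h [^] m)) e) \<le> b + 2 * D"
    by (simp add: act_gp act_closed h e gp_commute)
qed

text \<open>If \<open>s\<close> or \<open>t\<close> moves \<open>e\<close> far compared with the
  product of its forward and backward images, its square serves. Otherwise \<open>inv s\<close>
  sends \<open>e\<close> in nearly the direction of \<open>\<phi> s e\<close>, and similarly for
  \<open>t\<close>; as \<open>\<phi> s e\<close> and \<open>\<phi> t e\<close> diverge, so do
  \<open>\<phi> (inv s) e\<close> and \<open>\<phi> t e\<close>, and the product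
  \<open>s \<otimes> t\<close> serves.\<close>

lemma exists_loxodromic:
  assumes e: "e \<in> X" and s: "s \<in> carrier G" and t: "t \<in> carrier G"
    and st: "gp e (\<phi> s e) (\<phi> t e) \<le> K"
    and far: "2 * K + 8 * D < dX e (\<phi> s e)" "2 * K + 8 * D < dX e (\<phi> t e)"
  shows "\<exists>h\<in>carrier G. \<exists>c>0. \<exists>M. \<forall>m. real m * c \<le> dX e (\<phi> (h [^] m) e) \<and>
           gp e (\<phi> (h [^] m) e) (\<phi> (inv (h [^] m)) e) \<le> M"
proof -
  have K: "0 \<le> K" using gp_nonneg[of e "\<phi> s e" "\<phi> t e"] st e s t act_closed by force
  have square: ?thesis
    if g: "g \<in> carrier G" and lox: "2 * gp e (\<phi> (inv g) e) (\<phi> g e) + 3 * D < dX e (\<phi> g e)" for g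
  proof -
    define b where "b = gp e (\<phi> (inv g) e) (\<phi> g e)"
    have b: "0 \<le> b" unfolding b_def using gp_nonneg e g act_closed by simp
    have "0 < dX e (\<phi> g e) - 2 * b - 2 * D" using lox D_nonneg by (simp add: b_def)
    then show ?thesis
      using loxodromic_product[OF e g g b lox[folded b_def] order_refl order_refl]
      by (intro bexI[of _ "g \<otimes> g"] exI[of _ "dX e (\<phi> g e) - 2 * b - 2 * D"]
          exI[of _ "b + 2 * D"]) (auto simp: g b_def)
  qed
  consider "2 * gp e (\<phi> (inv s) e) (\<phi> s e) + 3 * D < dX e (\<phi> s e)"
    | "2 * gp e (\<phi> (inv t) e) (\<phi> t e) + 3 * D < dX e (\<phi> t e)"
    | "dX e (\<phi> s e) \<le> 2 * gp e (\<phi> (inv s) e) (\<phi> s e) + 3 * D"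
      "dX e (\<phi> t e) \<le> 2 * gp e (\<phi> (inv t) e) (\<phi> t e) + 3 * D"
    by linarith
  then show ?thesis
  proof cases
    case 1 then show ?thesis by (rule square[OF s])
  next
    case 2 then show ?thesis by (rule square[OF t])
  next
    case 3
    have "gp e (\<phi> (inv s) e) (\<phi> t e) \<le> K + D"
      using four_point[of e "\<phi> s e" "\<phi> (inv s) e" "\<phi> t e"] 3(1) far(1) st
        gp_commute[of e "\<phi> (inv s) e" "\<phi> s e"] e s t act_closed D_nonneg by fastforce
    moreover have "gp e (\<phi> (inv t) e) (\<phi> s e) \<le> K + D"
      using four_point[of e "\<phi> t e" "\<phi> (inv t) e" "\<phi> s e"] 3(2) far(2) st
        gp_commute[of e "\<phi> (inv t) e" "\<phi> t e"] gp_commute[of e "\<phi> s e" "\<phi> t e"]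
        e s t act_closed D_nonneg by fastforce
    moreover define a where "a = min (dX e (\<phi> s e)) (dX e (\<phi> t e))"
    ultimately have "real m * (a - 2 * (K + D) - 2 * D) \<le> dX e (\<phi> ((s \<otimes> t) [^] m) e)"
      "gp e (\<phi> ((s \<otimes> t) [^] m) e) (\<phi> (inv ((s \<otimes> t) [^] m)) e) \<le> K + D + 2 * D" for m
      using loxodromic_product[OF e s t, of "K + D" a m] far K D_nonneg by (auto simp: a_def)
    moreover have "0 < a - 2 * (K + D) - 2 * D" using far D_nonneg by (auto simp: a_def)
    ultimately show ?thesis using s t by (meson m_closed)
  qed
qed

section \<open>Group elements pointing to distinct limit points\<close>

text \<open>Distinct boundary points are distinct classes, so their sequences are inequivalent.
  Exchanging the orbits of \<open>p\<close> and \<open>q\<close> for that of \<open>e\<close> moves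
  all points by \<open>dX e p\<close> or \<open>dX e q\<close>, because the action is
  isometric.\<close>

lemma limit_set_gp_bounded:
  assumes \<xi>: "\<xi> \<in> limit_set G X dX \<phi>" and \<eta>: "\<eta> \<in> limit_set G X dX \<phi>" and "\<xi> \<noteq> \<eta>"
    and s: "\<And>n. s n \<in> carrier G" "p \<in> X" "(\<lambda>n. \<phi> (s n) p) \<in> \<xi>"
    and t: "\<And>n. t n \<in> carrier G" "q \<in> X" "(\<lambda>n. \<phi> (t n) q) \<in> \<eta>"
    and e: "e \<in> X"
  shows "\<exists>K N. \<forall>n\<ge>N. gp e (\<phi> (s n) e) (\<phi> (t n) e) \<le> K"
proof -
  have \<xi>\<eta>: "\<xi> \<in> gromov_sequences X dX // gromov_rel X dX" "\<eta> \<in> gromov_sequences X dX // gromov_rel X dX"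
    using \<xi> \<eta> by (auto simp: limit_set_def gromov_boundary_def)
  have "((\<lambda>n. \<phi> (s n) p), (\<lambda>n. \<phi> (t n) q)) \<notin> gromov_rel X dX"
    using quotient_eq_iff[OF equiv_gromov_rel \<xi>\<eta> s(3) t(3)] \<open>\<xi> \<noteq> \<eta>\<close> by simp
  moreover have "(\<lambda>n. \<phi> (s n) p) \<in> gromov_sequences X dX" "(\<lambda>n. \<phi> (t n) q) \<in> gromov_sequences X dX"
    using in_quotient_imp_subset[OF equiv_gromov_rel] \<xi>\<eta> s(3) t(3) by blast+
  ultimately obtain K N where N: "\<And>i j. \<lbrakk>N \<le> i; N \<le> j\<rbrakk> \<Longrightarrow> gp e (\<phi> (s i) p) (\<phi> (t j) q) \<le> K"
    using gromov_product_bounded_if_not_rel[OF _ _ _ e] by meson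
  have "gp e (\<phi> (s n) e) (\<phi> (t n) e) \<le> K + dX e p + dX e q" if "N \<le> n" for n
    using N[OF that that]
      gp_point_change[of e "\<phi> (s n) e" "\<phi> (s n) p" "\<phi> (t n) e"]
      gp_point_change[of e "\<phi> (t n) e" "\<phi> (t n) q" "\<phi> (s n) p"]
      gp_commute[of e "\<phi> (t n) e" "\<phi> (s n) p"] gp_commute[of e "\<phi> (t n) q" "\<phi> (s n) p"]
    by (simp add: s t e act_closed act_dist)
  then show ?thesis by blast
qed

text \<open>The diagonal products of a Gromov sequence already tend to infinity, and each is at most
  the distance from the base point.\<close>

lemma limit_set_dist_unbounded:
  assumes \<xi>: "\<xi> \<in> limit_set G X dX \<phi>"
    and s: "\<And>n. s n \<in> carrier G" "p \<in> X" "(\<lambda>n. \<phi> (s n) p) \<in> \<xi>"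
    and e: "e \<in> X"
  shows "\<exists>N. \<forall>n\<ge>N. T \<le> dX e (\<phi> (s n) e)"
proof -
  have "\<xi> \<in> gromov_sequences X dX // gromov_rel X dX"
    using \<xi> by (auto simp: limit_set_def gromov_boundary_def)
  then have "(\<lambda>n. \<phi> (s n) p) \<in> gromov_sequences X dX"
    using in_quotient_imp_subset[OF equiv_gromov_rel] s(3) by blast
  then obtain N where N: "\<And>i j. \<lbrakk>N \<le> i; N \<le> j\<rbrakk> \<Longrightarrow> T + dX e p \<le> gp e (\<phi> (s i) p) (\<phi> (s j) p)"
    using gromov_sequencesD[OF _ e] by meson
  have "T \<le> dX e (\<phi> (s n) e)" if "N \<le> n" for n
    using N[OF that that] gp_le_dist[of e "\<phi> (s n) p" "\<phi> (s n) p"]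
      triangle[of e "\<phi> (s n) e" "\<phi> (s n) p"] by (simp add: s e act_closed act_dist)
  then show ?thesis by blast
qed

text \<open>The order of quantifiers matters: \<open>K\<close> is fixed before \<open>T\<close>, so
  later thresholds for the distance may depend on \<open>K\<close>.\<close>

lemma three_limit_directions:
  assumes ne: "non_elementary_action G X dX \<phi>" and e: "e \<in> X"
  shows "\<exists>K. \<forall>T. \<exists>s1\<in>carrier G. \<exists>s2\<in>carrier G. \<exists>s3\<in>carrier G.
    T \<le> dX e (\<phi> s1 e) \<and> T \<le> dX e (\<phi> s2 e) \<and> T \<le> dX e (\<phi> s3 e) \<and>
    gp e (\<phi> s1 e) (\<phi> s2 e) \<le> K \<and> gp e (\<phi> s2 e) (\<phi> s3 e) \<le> K \<and> gp e (\<phi> s1 e) (\<phi> s3 e) \<le> K"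
proof -
  have "\<exists>B\<subseteq>limit_set G X dX \<phi>. card B = 3"
  proof (cases "finite (limit_set G X dX \<phi>)")
    case True
    then have "3 \<le> card (limit_set G X dX \<phi>)" using ne by (auto simp: non_elementary_action_def)
    then show ?thesis by (meson obtain_subset_with_card_n)
  next
    case False
    then show ?thesis using infinite_arbitrarily_large by blast
  qed
  then obtain \<xi>1 \<xi>2 \<xi>3 where \<xi>: "\<xi>1 \<in> limit_set G X dX \<phi>" "\<xi>2 \<in> limit_set G X dX \<phi>"
      "\<xi>3 \<in> limit_set G X dX \<phi>" "\<xi>1 \<noteq> \<xi>2" "\<xi>2 \<noteq> \<xi>3" "\<xi>1 \<noteq> \<xi>3"
    by (auto simp: card_3_iff)
  have seq: "\<exists>p s. p \<in> X \<and> (\<forall>n. s n \<in> carrier G) \<and> (\<lambda>n. \<phi> (s n) p) \<in> \<xi>"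
    if "\<xi> \<in> limit_set G X dX \<phi>" for \<xi>
    using that by (auto simp: limit_set_def)
  obtain p1 s1 where s1: "\<And>n. s1 n \<in> carrier G" "p1 \<in> X" "(\<lambda>n. \<phi> (s1 n) p1) \<in> \<xi>1"
    using seq[OF \<xi>(1)] by blast
  obtain p2 s2 where s2: "\<And>n. s2 n \<in> carrier G" "p2 \<in> X" "(\<lambda>n. \<phi> (s2 n) p2) \<in> \<xi>2"
    using seq[OF \<xi>(2)] by blast
  obtain p3 s3 where s3: "\<And>n. s3 n \<in> carrier G" "p3 \<in> X" "(\<lambda>n. \<phi> (s3 n) p3) \<in> \<xi>3"
    using seq[OF \<xi>(3)] by blast
  obtain K1 N1 where 1: "\<And>n. N1 \<le> n \<Longrightarrow> gp e (\<phi> (s1 n) e) (\<phi> (s2 n) e) \<le> K1"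
    using limit_set_gp_bounded[OF \<xi>(1,2,4) s1 s2 e] by blast
  obtain K2 N2 where 2: "\<And>n. N2 \<le> n \<Longrightarrow> gp e (\<phi> (s2 n) e) (\<phi> (s3 n) e) \<le> K2"
    using limit_set_gp_bounded[OF \<xi>(2,3,5) s2 s3 e] by blast
  obtain K3 N3 where 3: "\<And>n. N3 \<le> n \<Longrightarrow> gp e (\<phi> (s1 n) e) (\<phi> (s3 n) e) \<le> K3"
    using limit_set_gp_bounded[OF \<xi>(1,3,6) s1 s3 e] by blast
  have "\<exists>s1\<in>carrier G. \<exists>s2\<in>carrier G. \<exists>s3\<in>carrier G.
      T \<le> dX e (\<phi> s1 e) \<and> T \<le> dX e (\<phi> s2 e) \<and> T \<le> dX e (\<phi> s3 e) \<and>
      gp e (\<phi> s1 e) (\<phi> s2 e) \<le> max K1 (max K2 K3) \<and>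
      gp e (\<phi> s2 e) (\<phi> s3 e) \<le> max K1 (max K2 K3) \<and>
      gp e (\<phi> s1 e) (\<phi> s3 e) \<le> max K1 (max K2 K3)" for T
  proof -
    obtain M1 where M1: "\<And>n. M1 \<le> n \<Longrightarrow> T \<le> dX e (\<phi> (s1 n) e)"
      using limit_set_dist_unbounded[OF \<xi>(1) s1 e] by blast
    obtain M2 where M2: "\<And>n. M2 \<le> n \<Longrightarrow> T \<le> dX e (\<phi> (s2 n) e)"
      using limit_set_dist_unbounded[OF \<xi>(2) s2 e] by blast
    obtain M3 where M3: "\<And>n. M3 \<le> n \<Longrightarrow> T \<le> dX e (\<phi> (s3 n) e)"
      using limit_set_dist_unbounded[OF \<xi>(3) s3 e] by blast
    define n where "n = Max {N1, N2, N3, M1, M2, M3}"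
    have "N1 \<le> n" "N2 \<le> n" "N3 \<le> n" "M1 \<le> n" "M2 \<le> n" "M3 \<le> n"
      unfolding n_def by auto
    then show ?thesis
      using 1[of n] 2[of n] 3[of n] M1[of n] M2[of n] M3[of n] s1(1) s2(1) s3(1)
      by (intro bexI[of _ "s1 n"] bexI[of _ "s2 n"] bexI[of _ "s3 n"]) auto
  qed
  then show ?thesis by blast
qed

text \<open>The point \<open>\<phi> (inv g) e\<close> cannot lie in the directions of both
  \<open>\<phi> y e\<close> and \<open>\<phi> (inv y) e\<close>. For the one it avoids, the path
  from \<open>e\<close> over \<open>\<phi> g e\<close> to \<open>\<phi> (g \<otimes> z) e\<close>
  hardly backtracks.\<close>

lemma translated_power_direction:
  assumes e: "e \<in> X" and g: "g \<in> carrier G" and y: "y \<in> carrier G"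
    and M: "gp e (\<phi> y e) (\<phi> (inv y) e) \<le> M"
  shows "\<exists>z\<in>{y, inv y}. dX e (\<phi> g e) - M - D \<le> gp e (\<phi> g e) (\<phi> (g \<otimes> z) e)"
proof -
  have eq: "gp e (\<phi> g e) (\<phi> (g \<otimes> z) e) = dX e (\<phi> g e) - gp e (\<phi> (inv g) e) (\<phi> z e)"
    if z: "z \<in> carrier G" for z
  proof -
    have "gp (\<phi> g e) e (\<phi> (g \<otimes> z) e) = gp e (\<phi> (inv g) e) (\<phi> z e)"
      using act_gp[OF g e act_closed[OF inv_closed[OF g] e] act_closed[OF z e]]
      by (simp add: composition_rule e g z act_inv_cancel)
    then show ?thesis using gp_add[of e "\<phi> g e" "\<phi> (g \<otimes> z) e"] by simp
  qed
  have "min (gp e (\<phi> y e) (\<phi> (inv g) e)) (gp e (\<phi> (inv g) e) (\<phi> (inv y) e)) - D \<le> M"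
    using four_point[of e "\<phi> y e" "\<phi> (inv g) e" "\<phi> (inv y) e"] M e g y act_closed by fastforce
  then show ?thesis
    using eq[of y] eq[of "inv y"] y gp_commute[of e "\<phi> y e"] by (auto simp: min_def split: if_splits)
qed

text \<open>The sign of the exponent may depend on \<open>m\<close>: it only matters that for each of three separated
  starting directions one of the two half-axes of \<open>h\<close> can be attached without backtracking.\<close>

lemma three_separated_rays:
  assumes ne: "non_elementary_action G X dX \<phi>" and e: "e \<in> X"
  obtains h c K s1 s2 s3 where "h \<in> carrier G" "c > 0"
    "\<And>m. real m * c \<le> dX e (\<phi> (h [^] m) e)"
    "s1 \<in> carrier G" "s2 \<in> carrier G" "s3 \<in> carrier G"
    "\<And>m::nat. \<exists>y1\<in>{h [^] m, inv (h [^] m)}. \<exists>y2\<in>{h [^] m, inv (h [^] m)}. \<exists>y3\<in>{h [^] m, inv (h [^] m)}.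
      gp e (\<phi> (s1 \<otimes> y1) e) (\<phi> (s2 \<otimes> y2) e) \<le> K \<and>
      gp e (\<phi> (s2 \<otimes> y2) e) (\<phi> (s3 \<otimes> y3) e) \<le> K \<and>
      gp e (\<phi> (s1 \<otimes> y1) e) (\<phi> (s3 \<otimes> y3) e) \<le> K"
proof -
  obtain K where K: "\<And>T. \<exists>s1\<in>carrier G. \<exists>s2\<in>carrier G. \<exists>s3\<in>carrier G.
    T \<le> dX e (\<phi> s1 e) \<and> T \<le> dX e (\<phi> s2 e) \<and> T \<le> dX e (\<phi> s3 e) \<and>
    gp e (\<phi> s1 e) (\<phi> s2 e) \<le> K \<and> gp e (\<phi> s2 e) (\<phi> s3 e) \<le> K \<and> gp e (\<phi> s1 e) (\<phi> s3 e) \<le> K"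
    using three_limit_directions[OF ne e] by blast
  obtain t1 t2 where t: "t1 \<in> carrier G" "t2 \<in> carrier G" "gp e (\<phi> t1 e) (\<phi> t2 e) \<le> K"
    "2 * K + 8 * D + 1 \<le> dX e (\<phi> t1 e)" "2 * K + 8 * D + 1 \<le> dX e (\<phi> t2 e)"
    using K[of "2 * K + 8 * D + 1"] by blast
  obtain h c M where h: "h \<in> carrier G" "c > 0" "\<And>m. real m * c \<le> dX e (\<phi> (h [^] m) e)"
    "\<And>m::nat. gp e (\<phi> (h [^] m) e) (\<phi> (inv (h [^] m)) e) \<le> M"
    using exists_loxodromic[OF e t(1-3)] t(4,5) by auto
  \<comment> \<open>These elements are chosen after \<open>h\<close>, far enough out for its
    constant \<open>M\<close>: after the loss of \<open>M + D\<close> in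
    \<open>translated_power_direction\<close>, more than the \<open>K + 2 * D\<close> required by
    \<open>gp_transfer\<close> remains.\<close>
  obtain s1 s2 s3 where s: "s1 \<in> carrier G" "s2 \<in> carrier G" "s3 \<in> carrier G"
    and far: "K + 3 * D + M + 1 \<le> dX e (\<phi> s1 e)" "K + 3 * D + M + 1 \<le> dX e (\<phi> s2 e)"
      "K + 3 * D + M + 1 \<le> dX e (\<phi> s3 e)"
    and sep: "gp e (\<phi> s1 e) (\<phi> s2 e) \<le> K" "gp e (\<phi> s2 e) (\<phi> s3 e) \<le> K"
      "gp e (\<phi> s1 e) (\<phi> s3 e) \<le> K"
    using K[of "K + 3 * D + M + 1"] by blast
  have ray: "\<exists>y\<in>{h [^] m, inv (h [^] m)}. K + 2 * D < gp e (\<phi> s e) (\<phi> (s \<otimes> y) e)"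
    if s: "s \<in> carrier G" and far: "K + 3 * D + M + 1 \<le> dX e (\<phi> s e)" for s and m :: nat
  proof -
    obtain z where z: "z \<in> {h [^] m, inv (h [^] m)}"
      "dX e (\<phi> s e) - M - D \<le> gp e (\<phi> s e) (\<phi> (s \<otimes> z) e)"
      using translated_power_direction[OF e s _ h(4)[of m]] h(1) by auto
    then have "K + 2 * D < gp e (\<phi> s e) (\<phi> (s \<otimes> z) e)" using far by linarith
    then show ?thesis using z(1) by blast
  qed
  show ?thesis
  proof (rule that[OF h(1,2,3) s, of "K + 2 * D"])
    fix m :: nat
    let ?Y = "{h [^] m, inv (h [^] m)}"
    obtain y1 where y1: "y1 \<in> ?Y" "K + 2 * D < gp e (\<phi> s1 e) (\<phi> (s1 \<otimes> y1) e)"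
      using ray[OF s(1) far(1)] by blast
    obtain y2 where y2: "y2 \<in> ?Y" "K + 2 * D < gp e (\<phi> s2 e) (\<phi> (s2 \<otimes> y2) e)"
      using ray[OF s(2) far(2)] by blast
    obtain y3 where y3: "y3 \<in> ?Y" "K + 2 * D < gp e (\<phi> s3 e) (\<phi> (s3 \<otimes> y3) e)"
      using ray[OF s(3) far(3)] by blast
    have Y: "y \<in> carrier G" if "y \<in> ?Y" for y using that h(1) by auto
    have mem: "\<phi> s1 e \<in> X" "\<phi> s2 e \<in> X" "\<phi> s3 e \<in> X"
      "\<phi> (s1 \<otimes> y1) e \<in> X" "\<phi> (s2 \<otimes> y2) e \<in> X" "\<phi> (s3 \<otimes> y3) e \<in> X"
      using Y[OF y1(1)] Y[OF y2(1)] Y[OF y3(1)] s e by (auto intro!: act_closed)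
    have "gp e (\<phi> (s1 \<otimes> y1) e) (\<phi> (s2 \<otimes> y2) e) \<le> K + 2 * D"
      by (rule gp_transfer[OF e mem(1,2,4,5) sep(1) y1(2) y2(2)])
    moreover have "gp e (\<phi> (s2 \<otimes> y2) e) (\<phi> (s3 \<otimes> y3) e) \<le> K + 2 * D"
      by (rule gp_transfer[OF e mem(2,3,5,6) sep(2) y2(2) y3(2)])
    moreover have "gp e (\<phi> (s1 \<otimes> y1) e) (\<phi> (s3 \<otimes> y3) e) \<le> K + 2 * D"
      by (rule gp_transfer[OF e mem(1,3,4,6) sep(3) y1(2) y3(2)])
    ultimately show "\<exists>y1\<in>?Y. \<exists>y2\<in>?Y. \<exists>y3\<in>?Y.
      gp e (\<phi> (s1 \<otimes> y1) e) (\<phi> (s2 \<otimes> y2) e) \<le> K + 2 * D \<and>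
      gp e (\<phi> (s2 \<otimes> y2) e) (\<phi> (s3 \<otimes> y3) e) \<le> K + 2 * D \<and>
      gp e (\<phi> (s1 \<otimes> y1) e) (\<phi> (s3 \<otimes> y3) e) \<le> K + 2 * D"
      using y1(1) y2(1) y3(1) by blast
  qed
qed

end

section \<open>Word length and the kernel of the action on the cone\<close>

locale generated_group = group G for G :: "('a, 'm) monoid_scheme" (structure) +
  fixes S :: "'a set"
  assumes gens_closed: "S \<subseteq> carrier G" and generated: "generate G S = carrier G"
begin

abbreviation letters :: "'a set" where "letters \<equiv> S \<union> m_inv G ` S"

abbreviation word_value :: "'a list \<Rightarrow> 'a" where
  "word_value ws \<equiv> foldr (\<lambda>a b. a \<otimes> b) ws \<one>"

abbreviation wl :: "'a \<Rightarrow> nat" where "wl \<equiv> word_length G S"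

lemma letters_closed: "letters \<subseteq> carrier G"
  using gens_closed by auto

lemma word_value_closed: "set ws \<subseteq> letters \<Longrightarrow> word_value ws \<in> carrier G"
  using letters_closed by (induction ws) auto

lemma word_value_append:
  assumes "set ws \<subseteq> letters" "set vs \<subseteq> letters"
  shows "word_value (ws @ vs) = word_value ws \<otimes> word_value vs"
  using assms(1)
proof (induction ws)
  case Nil
  then show ?case using word_value_closed[OF assms(2)] by simp
next
  case (Cons a ws)
  then have "a \<in> carrier G" using letters_closed by auto
  then show ?case
    using Cons word_value_closed[of ws] word_value_closed[OF assms(2)] by (simp add: m_assoc)
qed

lemma word_value_inv:
  assumes "set ws \<subseteq> letters"
  shows "word_value (rev (map (m_inv G) ws)) = inv (word_value ws)"
    and "set (rev (map (m_inv G) ws)) \<subseteq> letters"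
proof -
  have inv_letter: "inv a \<in> letters" if "a \<in> letters" for a
    using that gens_closed by (auto simp: subset_iff)
  show letters: "set (rev (map (m_inv G) ws)) \<subseteq> letters"
    using assms inv_letter by auto
  show "word_value (rev (map (m_inv G) ws)) = inv (word_value ws)"
    using assms
  proof (induction ws)
    case (Cons a ws)
    then have ws: "set ws \<subseteq> letters" and a: "a \<in> letters" by auto
    have "word_value (rev (map (m_inv G) ws) @ [inv a])
        = word_value (rev (map (m_inv G) ws)) \<otimes> word_value [inv a]"
      by (rule word_value_append) (use ws a inv_letter in auto)
    then show ?case
      using Cons.IH[OF ws] a ws letters_closed word_value_closed[OF ws] inv_mult_group[of a]
      by auto
  qed simp
qed

lemma word_exists:
  assumes "g \<in> carrier G"
  shows "\<exists>ws. set ws \<subseteq> letters \<and> word_value ws = g"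
proof -
  have "g \<in> generate G S" using assms generated by simp
  then show ?thesis
  proof induction
    case one
    then show ?case by (intro exI[of _ "[]"]) simp
  next
    case (incl h)
    then show ?case using gens_closed by (intro exI[of _ "[h]"]) auto
  next
    case (inv h)
    then show ?case using gens_closed by (intro exI[of _ "[inv h]"]) auto
  next
    case (eng g h)
    then obtain ws vs where "set ws \<subseteq> letters" "word_value ws = g" "set vs \<subseteq> letters" "word_value vs = h"
      by blast
    then show ?case using word_value_append by (intro exI[of _ "ws @ vs"]) auto
  qed
qed

lemma word_length_le: "\<lbrakk>set ws \<subseteq> letters; word_value ws = g\<rbrakk> \<Longrightarrow> wl g \<le> length ws"
  unfolding word_length_def by (rule Least_le) blast

text \<open>Generation makes the set of lengths in the definition of \<open>word_length\<close>
  non-empty, so that \<open>LEAST\<close> is attained.\<close>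

lemma shortest_word:
  assumes "g \<in> carrier G"
  obtains ws where "set ws \<subseteq> letters" "word_value ws = g" "length ws = wl g"
proof -
  obtain ws where "set ws \<subseteq> letters" "word_value ws = g" using word_exists[OF assms] by blast
  then have "\<exists>n ws. length ws = n \<and> set ws \<subseteq> letters \<and> word_value ws = g" by blast
  from LeastI_ex[OF this] show ?thesis
    using that by (auto simp: word_length_def)
qed

lemma word_length_one [simp]: "wl \<one> = 0"
  using word_length_le[of "[]" \<one>] by simp

lemma word_length_mult:
  assumes "g \<in> carrier G" "h \<in> carrier G"
  shows "wl (g \<otimes> h) \<le> wl g + wl h"
proof -
  obtain ws where ws: "set ws \<subseteq> letters" "word_value ws = g" "length ws = wl g"
    using shortest_word[OF assms(1)] .
  obtain vs where vs: "set vs \<subseteq> letters" "word_value vs = h" "length vs = wl h"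
    using shortest_word[OF assms(2)] .
  show ?thesis
    using word_length_le[of "ws @ vs" "g \<otimes> h"] word_value_append[OF ws(1) vs(1)] ws vs by simp
qed

lemma word_length_inv:
  assumes "g \<in> carrier G"
  shows "wl (inv g) = wl g"
proof -
  have le: "wl (inv h) \<le> wl h" if h: "h \<in> carrier G" for h
  proof -
    obtain ws where ws: "set ws \<subseteq> letters" "word_value ws = h" "length ws = wl h"
      using shortest_word[OF h] .
    show ?thesis using word_length_le[OF word_value_inv(2,1)[OF ws(1)]] ws by simp
  qed
  show ?thesis using le[OF assms] le[of "inv g"] assms by simp
qed

lemma word_length_pow:
  assumes "g \<in> carrier G"
  shows "wl (g [^] (n::nat)) \<le> n * wl g"
proof (induction n)
  case (Suc n)
  then show ?case using word_length_mult[of "g [^] n" g] assms by simp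
qed simp

end

section \<open>Admissible and sublinear sequences\<close>

locale asymptotic_cone = generated_group G S
  for G :: "('a, 'm) monoid_scheme" (structure) and S +
  fixes \<omega> :: "nat filter" and d :: "nat \<Rightarrow> real"
  assumes ultrafilter: "nonprincipal_ultrafilter \<omega>"
    and d_pos: "\<And>n. 0 < d n" and d_incseq: "incseq d" and d_unbounded: "\<not> bdd_above (range d)"
begin

abbreviation adm :: "(nat \<Rightarrow> 'a) set" where "adm \<equiv> admissible G S d"

lemma omega_neq_bot: "\<omega> \<noteq> bot"
  using ultrafilter by (simp add: nonprincipal_ultrafilter_def)

text \<open>An ultrafilter that is not principal contains the complement of each point, hence every
  tail.\<close>

lemma omega_le_sequentially: "\<omega> \<le> sequentially"
  unfolding le_sequentially
proof
  fix N
  have neq: "eventually (\<lambda>j. j \<noteq> i) \<omega>" for i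
    using ultrafilter unfolding nonprincipal_ultrafilter_def by metis
  show "eventually (\<lambda>n. N \<le> n) \<omega>"
  proof (induction N)
    case (Suc N)
    then show ?case using neq[of N] by eventually_elim auto
  qed simp
qed

lemma d_at_top: "filterlim d at_top \<omega>"
proof -
  have "filterlim d at_top sequentially"
    unfolding filterlim_at_top
  proof
    fix Z
    obtain N where "Z \<le> d N"
    proof (rule ccontr)
      assume "\<not> thesis"
      then have "d n \<le> Z" for n using that[of n] by fastforce
      then show False using d_unbounded bdd_aboveI2[of UNIV d Z] by simp
    qed
    then have "Z \<le> d n" if "N \<le> n" for n
      using incseqD[OF d_incseq that] by linarith
    then show "eventually (\<lambda>n. Z \<le> d n) sequentially" by (rule eventually_sequentiallyI)
  qed
  then show ?thesis using omega_le_sequentially filterlim_mono by blast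
qed

lemma const_over_d: "((\<lambda>n. B / d n) \<longlongrightarrow> 0) \<omega>"
  by (rule real_tendsto_divide_at_top[OF tendsto_const d_at_top])

lemma admissible_closed: "x \<in> adm \<Longrightarrow> x n \<in> carrier G"
  by (simp add: admissible_def)

text \<open>An additive constant is harmless since \<open>d n\<close> is bounded below by
  \<open>d 0\<close>, which is positive.\<close>

lemma admissibleI:
  assumes "\<And>n. x n \<in> carrier G" and "\<And>n. real (wl (x n)) \<le> A + C * d n" and "0 \<le> A"
  shows "x \<in> adm"
proof -
  have "real (wl (x n)) / d n \<le> A / d 0 + C" for n
  proof -
    have "real (wl (x n)) / d n \<le> (A + C * d n) / d n"
      using assms(2) d_pos[of n] by (intro divide_right_mono) auto
    also have "\<dots> = A / d n + C" using d_pos[of n] by (simp add: field_simps)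
    also have "A / d n \<le> A / d 0"
      using d_pos incseqD[OF d_incseq, of 0 n] \<open>0 \<le> A\<close> by (intro divide_left_mono) auto
    finally show ?thesis by simp
  qed
  then show ?thesis using assms(1) by (auto simp: admissible_def)
qed

lemma admissible_translate:
  assumes g: "g \<in> carrier G" and x: "x \<in> adm"
  shows "(\<lambda>n. g \<otimes> x n) \<in> adm"
proof -
  obtain C where C: "\<And>n. real (wl (x n)) / d n \<le> C" using x by (auto simp: admissible_def)
  show ?thesis
  proof (rule admissibleI)
    fix n
    have "real (wl (x n)) \<le> C * d n" using C[of n] d_pos[of n] by (simp add: field_simps)
    then show "real (wl (g \<otimes> x n)) \<le> real (wl g) + C * d n"
      using word_length_mult[OF g admissible_closed[OF x, of n]] by linarith
  qed (use g admissible_closed[OF x] in auto)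
qed

text \<open>For admissible sequences this means representing the base point of the cone.\<close>

definition sublinear :: "(nat \<Rightarrow> 'a) \<Rightarrow> bool" where
  "sublinear z \<longleftrightarrow> ((\<lambda>n. real (wl (z n)) / d n) \<longlongrightarrow> 0) \<omega>"

lemma sublinear_le:
  assumes "sublinear y" "sublinear z" "\<And>n. wl (x n) \<le> wl (y n) + wl (z n)"
  shows "sublinear x"
proof -
  have lim: "((\<lambda>n. real (wl (y n)) / d n + real (wl (z n)) / d n) \<longlongrightarrow> 0) \<omega>"
    using tendsto_add[OF assms(1)[unfolded sublinear_def] assms(2)[unfolded sublinear_def]] by simp
  have "real (wl (x n)) / d n \<le> real (wl (y n)) / d n + real (wl (z n)) / d n" for n
    using assms(3)[of n] d_pos[of n] unfolding add_divide_distrib[symmetric]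
    by (intro divide_right_mono) auto
  then show ?thesis
    unfolding sublinear_def using d_pos
    by (intro tendsto_sandwich[OF _ _ tendsto_const lim]) (auto simp: less_imp_le)
qed

lemma sublinear_one: "sublinear (\<lambda>n. \<one>)"
  by (simp add: sublinear_def)

lemma sublinear_mult:
  assumes "sublinear y" "sublinear z" "\<And>n. y n \<in> carrier G" "\<And>n. z n \<in> carrier G"
  shows "sublinear (\<lambda>n. y n \<otimes> z n)"
  by (rule sublinear_le[OF assms(1,2)]) (rule word_length_mult[OF assms(3,4)])

lemma sublinear_inv:
  assumes "sublinear y" "\<And>n. y n \<in> carrier G"
  shows "sublinear (\<lambda>n. inv (y n))"
  using assms by (simp add: sublinear_def word_length_inv)

lemma sublinear_bounded:
  assumes "\<And>n. wl (x n) \<le> B"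
  shows "sublinear x"
  unfolding sublinear_def
proof (rule tendsto_sandwich[OF _ _ tendsto_const const_over_d[of "real B"]])
  show "eventually (\<lambda>n. real (wl (x n)) / d n \<le> real B / d n) \<omega>"
    using assms d_pos by (intro always_eventually allI divide_right_mono) (auto simp: less_imp_le)
qed (auto simp: d_pos less_imp_le)

lemma cone_rel_iff:
  "(x, y) \<in> cone_rel G S \<omega> d \<longleftrightarrow> x \<in> adm \<and> y \<in> adm \<and> sublinear (\<lambda>n. inv (x n) \<otimes> y n)"
  by (simp add: cone_rel_def sublinear_def)

lemma equiv_cone_rel: "equiv adm (cone_rel G S \<omega> d)"
proof (rule equivI)
  show "cone_rel G S \<omega> d \<subseteq> adm \<times> adm" by (auto simp: cone_rel_def)
  show "refl_on adm (cone_rel G S \<omega> d)"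
    by (auto simp: refl_on_def cone_rel_iff admissible_closed sublinear_one)
  show "sym (cone_rel G S \<omega> d)"
  proof (rule symI)
    fix x y assume xy: "(x, y) \<in> cone_rel G S \<omega> d"
    then have mem: "x n \<in> carrier G" "y n \<in> carrier G" for n
      by (auto simp: cone_rel_iff admissible_closed)
    have "sublinear (\<lambda>n. inv (inv (x n) \<otimes> y n))"
      using xy by - (rule sublinear_inv, auto simp: cone_rel_iff mem)
    then show "(y, x) \<in> cone_rel G S \<omega> d"
      using xy by (simp add: cone_rel_iff inv_mult_group mem)
  qed
  show "trans (cone_rel G S \<omega> d)"
  proof (rule transI)
    fix x y z assume xy: "(x, y) \<in> cone_rel G S \<omega> d" and yz: "(y, z) \<in> cone_rel G S \<omega> d"
    then have mem: "x n \<in> carrier G" "y n \<in> carrier G" "z n \<in> carrier G" for n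
      by (auto simp: cone_rel_iff admissible_closed)
    have "sublinear (\<lambda>n. (inv (x n) \<otimes> y n) \<otimes> (inv (y n) \<otimes> z n))"
      using xy yz by - (rule sublinear_mult, auto simp: cone_rel_iff mem)
    moreover have "(inv (x n) \<otimes> y n) \<otimes> (inv (y n) \<otimes> z n) = inv (x n) \<otimes> z n" for n
      using mem[of n] by (simp add: m_assoc inv_solve_left' flip: m_assoc[of "y n" "inv (y n)"])
    ultimately show "(x, z) \<in> cone_rel G S \<omega> d"
      using xy yz by (simp add: cone_rel_iff)
  qed
qed

section \<open>The kernel in terms of conjugates\<close>

definition cone_kernel :: "'a set" where
  "cone_kernel = {g \<in> carrier G. \<forall>x\<in>adm. sublinear (\<lambda>n. inv (x n) \<otimes> (g \<otimes> x n))}"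

lemma cone_kernelD:
  "\<lbrakk>g \<in> cone_kernel; x \<in> adm\<rbrakk> \<Longrightarrow> sublinear (\<lambda>n. inv (x n) \<otimes> (g \<otimes> x n))"
  by (simp add: cone_kernel_def)

text \<open>The unit of \<open>BijGroup\<close> is the restricted identity, so the comparison takes
  place on classes only. A class is fixed by \<open>g\<close> iff \<open>g\<close> moves its
  representatives within it.\<close>

lemma kernel_cone_action:
  "kernel G (BijGroup (Cone G S \<omega> d)) (cone_action G S \<omega> d) = cone_kernel"
proof -
  let ?r = "cone_rel G S \<omega> d"
  have "cone_action G S \<omega> d g = (\<lambda>p\<in>Cone G S \<omega> d. p) \<longleftrightarrow> g \<in> cone_kernel" if g: "g \<in> carrier G" for g
  proof
    assume eq: "cone_action G S \<omega> d g = (\<lambda>p\<in>Cone G S \<omega> d. p)"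
    have "(x, \<lambda>n. g \<otimes> x n) \<in> ?r" if x: "x \<in> adm" for x
    proof -
      let ?p = "?r `` {x}"
      have p: "?p \<in> Cone G S \<omega> d" using x by (simp add: Cone_def quotientI)
      have "x \<in> ?p" using equiv_class_self[OF equiv_cone_rel x] .
      moreover have "(\<lambda>n. g \<otimes> x n, \<lambda>n. g \<otimes> x n) \<in> ?r"
        using equiv_class_self[OF equiv_cone_rel admissible_translate[OF g x]] by simp
      ultimately have "(\<lambda>n. g \<otimes> x n) \<in> ?r `` ((\<lambda>x n. g \<otimes> x n) ` ?p)" by blast
      also have "\<dots> = cone_action G S \<omega> d g ?p" using p by (simp add: cone_action_def)
      also have "\<dots> = ?p" using p by (simp add: eq)
      finally show ?thesis by simp
    qed
    then show "g \<in> cone_kernel" using g by (simp add: cone_kernel_def cone_rel_iff)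
  next
    assume "g \<in> cone_kernel"
    then have rel: "(x, \<lambda>n. g \<otimes> x n) \<in> ?r" if "x \<in> adm" for x
      using that admissible_translate[OF g] by (simp add: cone_kernel_def cone_rel_iff)
    have "?r `` ((\<lambda>x n. g \<otimes> x n) ` p) = p" if p: "p \<in> Cone G S \<omega> d" for p
    proof -
      have p': "p \<in> adm // ?r" using p by (simp add: Cone_def)
      have sub: "p \<subseteq> adm" using in_quotient_imp_subset[OF equiv_cone_rel p'] .
      have closed: "p = ?r `` {x}" if "x \<in> p" for x
        using p' that by (metis Image_singleton_iff equiv_class_eq equiv_cone_rel quotientE)
      have "?r `` {\<lambda>n. g \<otimes> x n} = p" if "x \<in> p" for x
        using closed[OF that] equiv_class_eq[OF equiv_cone_rel rel] sub that by auto
      moreover have "p \<noteq> {}" using in_quotient_imp_non_empty[OF equiv_cone_rel p'] .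
      ultimately show ?thesis by auto
    qed
    then show "cone_action G S \<omega> d g = (\<lambda>p\<in>Cone G S \<omega> d. p)"
      unfolding cone_action_def by (rule restrict_ext)
  qed
  then show ?thesis by (auto simp: kernel_def BijGroup_def cone_kernel_def)
qed

text \<open>Conjugation by \<open>f\<close> amounts to replacing the test sequence \<open>x\<close>
  by its translate under \<open>inv f\<close>, which is again admissible.\<close>

lemma cone_kernel_normal: "cone_kernel \<lhd> G"
proof (rule normal_invI)
  show "subgroup cone_kernel G"
  proof
    show "cone_kernel \<subseteq> carrier G" by (auto simp: cone_kernel_def)
    show "\<one> \<in> cone_kernel"
      by (simp add: cone_kernel_def admissible_closed sublinear_one)
    show "g \<otimes> h \<in> cone_kernel" if "g \<in> cone_kernel" "h \<in> cone_kernel" for g h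
    proof -
      have gh: "g \<in> carrier G" "h \<in> carrier G" using that by (auto simp: cone_kernel_def)
      have "sublinear (\<lambda>n. inv (x n) \<otimes> (g \<otimes> h \<otimes> x n))" if x: "x \<in> adm" for x
      proof -
        note mem = admissible_closed[OF x]
        have "sublinear (\<lambda>n. (inv (x n) \<otimes> (g \<otimes> x n)) \<otimes> (inv (x n) \<otimes> (h \<otimes> x n)))"
          using \<open>g \<in> cone_kernel\<close> \<open>h \<in> cone_kernel\<close> x gh mem
          by - (rule sublinear_mult, auto simp: cone_kernel_def)
        moreover have "(inv (x n) \<otimes> (g \<otimes> x n)) \<otimes> (inv (x n) \<otimes> (h \<otimes> x n))
            = inv (x n) \<otimes> (g \<otimes> h \<otimes> x n)" for n
          using mem[of n] gh by (simp add: m_assoc flip: m_assoc[of "x n" "inv (x n)"])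
        ultimately show ?thesis by simp
      qed
      then show ?thesis using gh by (simp add: cone_kernel_def)
    qed
    show "inv g \<in> cone_kernel" if "g \<in> cone_kernel" for g
    proof -
      have g: "g \<in> carrier G" using that by (auto simp: cone_kernel_def)
      have "sublinear (\<lambda>n. inv (x n) \<otimes> (inv g \<otimes> x n))" if x: "x \<in> adm" for x
      proof -
        note mem = admissible_closed[OF x]
        have "sublinear (\<lambda>n. inv (inv (x n) \<otimes> (g \<otimes> x n)))"
          using \<open>g \<in> cone_kernel\<close> x g mem by - (rule sublinear_inv, auto simp: cone_kernel_def)
        then show ?thesis using mem g by (simp add: inv_mult_group m_assoc)
      qed
      then show ?thesis using g by (simp add: cone_kernel_def)
    qed
  qed
  show "f \<otimes> g \<otimes> inv f \<in> cone_kernel" if f: "f \<in> carrier G" and "g \<in> cone_kernel" for f g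
  proof -
    have g: "g \<in> carrier G" using that by (auto simp: cone_kernel_def)
    have "sublinear (\<lambda>n. inv (x n) \<otimes> (f \<otimes> g \<otimes> inv f \<otimes> x n))" if x: "x \<in> adm" for x
    proof -
      note mem = admissible_closed[OF x]
      have "(\<lambda>n. inv f \<otimes> x n) \<in> adm" using admissible_translate[OF _ x] f by simp
      then have "sublinear (\<lambda>n. inv (inv f \<otimes> x n) \<otimes> (g \<otimes> (inv f \<otimes> x n)))"
        by (rule cone_kernelD[OF \<open>g \<in> cone_kernel\<close>])
      then show ?thesis using mem g f by (simp add: inv_mult_group m_assoc)
    qed
    then show ?thesis using f g by (simp add: cone_kernel_def)
  qed
qed

lemma finite_normal_subset_cone_kernel:
  assumes "M \<lhd> G" "finite M"
  shows "M \<subseteq> cone_kernel"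
proof
  fix g assume "g \<in> M"
  then have g: "g \<in> carrier G" using normal_imp_subgroup[OF assms(1)] subgroup.subset by blast
  have "sublinear (\<lambda>n. inv (x n) \<otimes> (g \<otimes> x n))" if x: "x \<in> adm" for x
  proof (rule sublinear_bounded)
    fix n
    note mem = admissible_closed[OF x, of n]
    have "inv (x n) \<otimes> (g \<otimes> x n) \<in> M"
      using normal.inv_op_closed1[OF assms(1) mem \<open>g \<in> M\<close>] mem g by (simp add: m_assoc)
    then show "wl (inv (x n) \<otimes> (g \<otimes> x n)) \<le> Max (wl ` M)" using assms(2) by simp
  qed
  then show "g \<in> cone_kernel" using g by (simp add: cone_kernel_def)
qed

end

section \<open>Finiteness of the kernel\<close>

locale acylindrical_cone = asymptotic_cone G S \<omega> d + hyperbolic_action X dX D G \<phi>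
  for G :: "('a, 'm) monoid_scheme" (structure) and S \<omega> d and X :: "'x set" and dX D \<phi> +
  assumes finite_gens: "finite S"
begin

text \<open>Finitely many letters move \<open>e\<close> by a bounded amount, and displacements add
  along a word. Inserting 1 makes the maximum exist and be positive even without generators.\<close>

lemma orbit_map_lipschitz:
  assumes e: "e \<in> X"
  shows "\<exists>L>0. \<forall>g\<in>carrier G. dX e (\<phi> g e) \<le> L * real (wl g)"
proof -
  define L where "L = Max (insert 1 ((\<lambda>s. dX e (\<phi> s e)) ` letters))"
  have fin: "finite (insert 1 ((\<lambda>s. dX e (\<phi> s e)) ` letters))" using finite_gens by simp
  have L: "1 \<le> L" "\<And>s. s \<in> letters \<Longrightarrow> dX e (\<phi> s e) \<le> L"
    using Max_ge[OF fin] unfolding L_def by auto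
  have word: "dX e (\<phi> (word_value ws) e) \<le> L * real (length ws)" if "set ws \<subseteq> letters" for ws
    using that
  proof (induction ws)
    case Nil
    then show ?case by (simp add: act_one e)
  next
    case (Cons a ws)
    have a: "a \<in> carrier G" and w: "word_value ws \<in> carrier G"
      using Cons.prems letters_closed word_value_closed[of ws] by auto
    have "dX e (\<phi> (a \<otimes> word_value ws) e)
        \<le> dX e (\<phi> a e) + dX (\<phi> a e) (\<phi> a (\<phi> (word_value ws) e))"
      using triangle[of e "\<phi> a e"] e a w by (simp add: composition_rule act_closed)
    also have "\<dots> = dX e (\<phi> a e) + dX e (\<phi> (word_value ws) e)"
      by (simp add: act_dist act_closed a w e)
    also have "\<dots> \<le> L + L * real (length ws)"
      using Cons L(2)[of a] by (intro add_mono) auto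
    finally show ?case by (simp add: algebra_simps)
  qed
  have "dX e (\<phi> g e) \<le> L * real (wl g)" if "g \<in> carrier G" for g
    using shortest_word[OF that] word by metis
  then show ?thesis using L(1) by (intro exI[of _ L]) auto
qed

text \<open>Elements of the kernel displace a sequence with linear progress in \<open>X\<close> only sublinearly, so
  they fix its direction.\<close>

lemma cone_kernel_fixes_direction:
  assumes e: "e \<in> X" and k: "k \<in> cone_kernel" and x: "x \<in> adm" and "0 < c"
    and progress: "\<And>n. c * d n - A \<le> dX e (\<phi> (x n) e)"
  shows "eventually (\<lambda>n. T < gp e (\<phi> (x n) e) (\<phi> k (\<phi> (x n) e))) \<omega>"
proof -
  obtain L where "L > 0" and L: "\<And>g. g \<in> carrier G \<Longrightarrow> dX e (\<phi> g e) \<le> L * real (wl g)"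
    using orbit_map_lipschitz[OF e] by blast
  have kG: "k \<in> carrier G" using k by (simp add: cone_kernel_def)
  note xG = admissible_closed[OF x]
  have "((\<lambda>n. real (wl (inv (x n) \<otimes> (k \<otimes> x n))) / d n) \<longlongrightarrow> 0) \<omega>"
    using k x by (simp add: cone_kernel_def sublinear_def)
  \<comment> \<open>The threshold \<open>c / L\<close> bounds the displacement of
    \<open>\<phi> (x n) e\<close> by \<open>c * d n\<close>. Twice the progress is about
    \<open>2 * c * d n\<close>, so about \<open>c * d n\<close> is left for twice the
    product.\<close>
  then have "eventually (\<lambda>n. real (wl (inv (x n) \<otimes> (k \<otimes> x n))) / d n < c / L) \<omega>"
    by (rule order_tendstoD) (use \<open>0 < c\<close> \<open>0 < L\<close> in simp)
  moreover have "eventually (\<lambda>n. 2 * (T + A + dX e (\<phi> k e)) / c < d n) \<omega>"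
    using d_at_top by (simp add: filterlim_at_top_dense)
  ultimately show ?thesis
  proof eventually_elim
    case (elim n)
    let ?y = "\<phi> (x n) e"
    have y: "?y \<in> X" using act_closed[OF xG e] .
    \<comment> \<open>The displacement of \<open>?y\<close> by \<open>k\<close> is that of
      \<open>e\<close> by the conjugate, whose word length is sublinear.\<close>
    have "\<phi> k ?y = \<phi> (x n) (\<phi> (inv (x n) \<otimes> (k \<otimes> x n)) e)"
      using xG[of n] kG e by (simp add: composition_rule act_inv_cancel act_closed)
    then have "dX ?y (\<phi> k ?y) = dX e (\<phi> (inv (x n) \<otimes> (k \<otimes> x n)) e)"
      using xG[of n] kG e by (simp add: act_dist act_closed)
    also have "\<dots> \<le> L * real (wl (inv (x n) \<otimes> (k \<otimes> x n)))" using L xG[of n] kG by simp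
    also have "\<dots> \<le> c * d n"
      using elim(1) d_pos[of n] \<open>0 < L\<close> by (simp add: field_simps)
    finally have "dX ?y (\<phi> k ?y) \<le> c * d n" .
    moreover have "dX e ?y \<le> dX e (\<phi> k e) + dX e (\<phi> k ?y)"
      using triangle[of "\<phi> k e" e "\<phi> k ?y"] act_dist[OF kG e y] e y kG
      by (simp add: act_closed commute)
    moreover have "2 * (T + A + dX e (\<phi> k e)) < c * d n"
      using elim(2) \<open>0 < c\<close> by (simp add: field_simps)
    moreover have "0 \<le> dX e (\<phi> k e)" by simp
    ultimately have "2 * T < dX e ?y + dX e (\<phi> k ?y) - dX ?y (\<phi> k ?y)"
      using progress[of n] by (smt (verit))
    then show ?case by (simp add: gromov_product_def)
  qed
qed

text \<open>The rays and \<open>K\<close> are fixed before \<open>k\<close>. Only the index at which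
  \<open>k\<close> fixes all three directions depends on \<open>k\<close>, and the final bound does
  not mention that index.\<close>

lemma cone_kernel_displacement:
  assumes ne: "non_elementary_action G X dX \<phi>" and e: "e \<in> X"
  shows "\<exists>B. \<forall>k\<in>cone_kernel. dX e (\<phi> k e) \<le> B"
proof -
  obtain h c K s1 s2 s3 where h: "h \<in> carrier G" "c > 0"
      "\<And>m. real m * c \<le> dX e (\<phi> (h [^] m) e)"
    and s: "s1 \<in> carrier G" "s2 \<in> carrier G" "s3 \<in> carrier G"
    and rays: "\<And>m::nat. \<exists>y1\<in>{h [^] m, inv (h [^] m)}. \<exists>y2\<in>{h [^] m, inv (h [^] m)}.
      \<exists>y3\<in>{h [^] m, inv (h [^] m)}.
      gp e (\<phi> (s1 \<otimes> y1) e) (\<phi> (s2 \<otimes> y2) e) \<le> K \<and>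
      gp e (\<phi> (s2 \<otimes> y2) e) (\<phi> (s3 \<otimes> y3) e) \<le> K \<and>
      gp e (\<phi> (s1 \<otimes> y1) e) (\<phi> (s3 \<otimes> y3) e) \<le> K"
    by (rule three_separated_rays[OF ne e]) (rule that)
  \<comment> \<open>An exponent comparable to \<open>d n\<close> keeps the word length linear in
    \<open>d n\<close> while the distance in \<open>X\<close> grows linearly as well.\<close>
  define m where "m n = nat \<lfloor>d n\<rfloor>" for n
  have m: "real (m n) \<le> d n" "d n - 1 \<le> real (m n)" for n
    using d_pos[of n] unfolding m_def by linarith+
  let ?Y = "\<lambda>n. {h [^] m n, inv (h [^] m n)}"
  obtain y1 y2 y3 where y: "\<And>n. y1 n \<in> ?Y n" "\<And>n. y2 n \<in> ?Y n" "\<And>n. y3 n \<in> ?Y n"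
    and sep: "\<And>n. gp e (\<phi> (s1 \<otimes> y1 n) e) (\<phi> (s2 \<otimes> y2 n) e) \<le> K"
      "\<And>n. gp e (\<phi> (s2 \<otimes> y2 n) e) (\<phi> (s3 \<otimes> y3 n) e) \<le> K"
      "\<And>n. gp e (\<phi> (s1 \<otimes> y1 n) e) (\<phi> (s3 \<otimes> y3 n) e) \<le> K"
    using rays[of "m _"] by metis
  have YG: "z \<in> carrier G" if "z \<in> ?Y n" for z n using that h(1) by auto
  have fixes_ray: "eventually (\<lambda>n. K + 2 * D < gp e (\<phi> (s \<otimes> z n) e) (\<phi> k (\<phi> (s \<otimes> z n) e))) \<omega>"
    if k: "k \<in> cone_kernel" and s: "s \<in> carrier G" and z: "\<And>n. z n \<in> ?Y n" for k s z
  proof (rule cone_kernel_fixes_direction[OF e k _ h(2)])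
    have zG: "z n \<in> carrier G" for n using YG[OF z] .
    show "(\<lambda>n. s \<otimes> z n) \<in> adm"
    proof (rule admissibleI)
      fix n
      have "wl (z n) \<le> m n * wl h"
        using z[of n] word_length_pow[OF h(1), of "m n"] word_length_inv[of "h [^] m n"] h(1) by auto
      then have "real (wl (z n)) \<le> real (m n) * real (wl h)" by (metis of_nat_le_iff of_nat_mult)
      also have "\<dots> \<le> real (wl h) * d n" using mult_left_mono[OF m(1)[of n], of "real (wl h)"] by (simp add: mult.commute)
      finally show "real (wl (s \<otimes> z n)) \<le> real (wl s) + real (wl h) * d n"
        using word_length_mult[OF s zG[of n]] by linarith
    qed (use s zG in auto)
    show "c * d n - (c + dX e (\<phi> s e)) \<le> dX e (\<phi> (s \<otimes> z n) e)" for n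
    proof -
      have hm: "h [^] m n \<in> carrier G" using h(1) by simp
      have "c * (d n - 1) \<le> c * real (m n)" using m(2)[of n] h(2) by (intro mult_left_mono) auto
      also have "\<dots> \<le> dX e (\<phi> (h [^] m n) e)" using h(3)[of "m n"] by (simp add: mult.commute)
      \<comment> \<open>The sign of the exponent does not affect the distance, since an element and
        its inverse move \<open>e\<close> equally far.\<close>
      also have "\<dots> = dX e (\<phi> (z n) e)"
        using z[of n] act_dist_inv[OF hm e e] by (auto simp: commute)
      also have "\<dots> = dX (\<phi> s e) (\<phi> (s \<otimes> z n) e)"
        using act_dist[OF s e act_closed[OF zG e]] composition_rule[OF e s zG] by simp
      also have "\<dots> \<le> dX e (\<phi> s e) + dX e (\<phi> (s \<otimes> z n) e)"
        using triangle[of "\<phi> s e" e "\<phi> (s \<otimes> z n) e"] e s zG by (simp add: act_closed commute)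
      finally show ?thesis by (simp add: algebra_simps)
    qed
  qed
  have "dX e (\<phi> k e) \<le> 2 * K + 6 * D" if k: "k \<in> cone_kernel" for k
  proof -
    have kG: "k \<in> carrier G" using k by (simp add: cone_kernel_def)
    \<comment> \<open>The three events hold together eventually along \<omega>, and a single common
      index is enough.\<close>
    obtain n where n: "K + 2 * D < gp e (\<phi> (s1 \<otimes> y1 n) e) (\<phi> k (\<phi> (s1 \<otimes> y1 n) e))"
      "K + 2 * D < gp e (\<phi> (s2 \<otimes> y2 n) e) (\<phi> k (\<phi> (s2 \<otimes> y2 n) e))"
      "K + 2 * D < gp e (\<phi> (s3 \<otimes> y3 n) e) (\<phi> k (\<phi> (s3 \<otimes> y3 n) e))"
      using eventually_happens'[OF omega_neq_bot eventually_conj[OF fixes_ray[OF k s(1) y(1)]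
        eventually_conj[OF fixes_ray[OF k s(2) y(2)] fixes_ray[OF k s(3) y(3)]]]] by blast
    have mem: "\<phi> (s1 \<otimes> y1 n) e \<in> X" "\<phi> (s2 \<otimes> y2 n) e \<in> X" "\<phi> (s3 \<otimes> y3 n) e \<in> X"
      using s YG[OF y(1)] YG[OF y(2)] YG[OF y(3)] e by (auto intro!: act_closed)
    note kmem = act_closed[OF kG mem(1)] act_closed[OF kG mem(2)] act_closed[OF kG mem(3)]
    show ?thesis
      by (rule dist_moved_centre[OF e act_closed[OF kG e] mem kmem sep _ _ _ n])
        (simp_all add: act_gp kG e mem sep)
  qed
  then show ?thesis by blast
qed

text \<open>Normality carries the bound at \<open>e\<close> over to \<open>\<phi> f e\<close>, where
  \<open>f\<close> moves \<open>e\<close> at least as far as acylindricity demands.\<close>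

lemma finite_cone_kernel:
  assumes ac: "acylindrical_action G X dX \<phi>" and ne: "non_elementary_action G X dX \<phi>" and e: "e \<in> X"
  shows "finite cone_kernel"
proof -
  obtain B where B: "\<And>k. k \<in> cone_kernel \<Longrightarrow> dX e (\<phi> k e) \<le> B"
    using cone_kernel_displacement[OF ne e] by blast
  \<comment> \<open>Acylindricity is stated for positive \<epsilon> only.\<close>
  define \<epsilon> where "\<epsilon> = max B 1"
  have \<epsilon>: "dX e (\<phi> k e) \<le> \<epsilon>" if "k \<in> cone_kernel" for k
    using B[OF that] by (simp add: \<epsilon>_def)
  have "0 < \<epsilon>" by (simp add: \<epsilon>_def)
  then obtain R where R: "\<And>x y. \<lbrakk>x \<in> X; y \<in> X; R \<le> dX x y\<rbrakk> \<Longrightarrow>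
      finite {g\<in>carrier G. dX x (\<phi> g x) \<le> \<epsilon> \<and> dX y (\<phi> g y) \<le> \<epsilon>}"
    using ac unfolding acylindrical_action_def by meson
  obtain f where f: "f \<in> carrier G" "R \<le> dX e (\<phi> f e)"
    using three_limit_directions[OF ne e] by blast
  have "dX (\<phi> f e) (\<phi> k (\<phi> f e)) \<le> \<epsilon>" if k: "k \<in> cone_kernel" for k
  proof -
    have kG: "k \<in> carrier G" using k by (simp add: cone_kernel_def)
    have "\<phi> k (\<phi> f e) = \<phi> f (\<phi> (inv f \<otimes> k \<otimes> f) e)"
      using f(1) kG e by (simp add: composition_rule act_inv_cancel act_closed)
    then have "dX (\<phi> f e) (\<phi> k (\<phi> f e)) = dX e (\<phi> (inv f \<otimes> k \<otimes> f) e)"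
      using f(1) kG e by (simp add: act_dist act_closed)
    also have "\<dots> \<le> \<epsilon>" by (rule \<epsilon>[OF normal.inv_op_closed1[OF cone_kernel_normal f(1) k]])
    finally show ?thesis .
  qed
  then have "cone_kernel \<subseteq>
      {g\<in>carrier G. dX e (\<phi> g e) \<le> \<epsilon> \<and> dX (\<phi> f e) (\<phi> g (\<phi> f e)) \<le> \<epsilon>}"
    using \<epsilon> by (auto simp: cone_kernel_def)
  then show ?thesis
    using R[OF e act_closed[OF f(1) e] f(2)] finite_subset by blast
qed

end

theorem theorem1p1:
  fixes G :: "('a, 'm) monoid_scheme" (structure)
    and S :: "'a set"
    and \<omega> :: "nat filter"
    and d :: "nat \<Rightarrow> real"
  assumes "group G"
    and "finite S" and "S \<subseteq> carrier G" and "generate G S = carrier G"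
    and "acylindrically_hyperbolic TYPE('x) G"
    and "nonprincipal_ultrafilter \<omega>"
    and "\<And>n. 0 < d n" and "incseq d" and "\<not> bdd_above (range d)"
  shows "kernel G (BijGroup (Cone G S \<omega> d)) (cone_action G S \<omega> d) = max_finite_normal G"
proof -
  obtain X :: "'x set" and dX \<delta> \<phi> where hyp: "delta_hyperbolic X dX \<delta>"
    and ac: "acylindrical_action G X dX \<phi>" and ne: "non_elementary_action G X dX \<phi>"
    using assms(5) unfolding acylindrically_hyperbolic_def by blast
  have "limit_set G X dX \<phi> \<noteq> {}" using ne by (auto simp: non_elementary_action_def)
  then obtain e where e: "e \<in> X" by (auto simp: limit_set_def)
  then have "gromov_hyperbolic X dX (3 * \<delta> + 2)"
    using delta_hyperbolic_imp_gromov_hyperbolic[OF hyp] by blast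
  then interpret acylindrical_cone G S \<omega> d X dX "3 * \<delta> + 2" \<phi>
    using assms ac
    by (intro acylindrical_cone.intro asymptotic_cone.intro generated_group.intro
        hyperbolic_action.intro asymptotic_cone_axioms.intro generated_group_axioms.intro
        hyperbolic_action_axioms.intro acylindrical_cone_axioms.intro)
      (auto simp: acylindrical_action_def)
  have "is_max_finite_normal G cone_kernel"
    unfolding is_max_finite_normal_def
    using cone_kernel_normal finite_cone_kernel[OF ac ne e] finite_normal_subset_cone_kernel by blast
  \<comment> \<open>Two maximal finite normal subgroups contain each other, so the description by
    \<open>THE\<close> is unique.\<close>
  then have "max_finite_normal G = cone_kernel"
    unfolding max_finite_normal_def
    by (intro the_equality) (auto simp: is_max_finite_normal_def)
  then show ?thesis by (simp add: kernel_cone_action)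
qed

end
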